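(* Let $b$ be a positive integer. Every nonnegative integer can be written as $x^2+by^2+(z^2+zw+w^2)$ with $x,y,z,w\in\mathbb{Z}$ if and only if $b\in\{1,2,3,4,5,6\}$. *)

theory Defs
  imports Main
begin

end

theory Submission
  imports Defs "HOL-Number_Theory.Number_Theory" "HOL-Computational_Algebra.Squarefree"
begin

text \<open>
  The form with \<open>b \<ge> 7\<close> misses 6. For \<open>b \<le> 6\<close> everything rests on the ternary form
  \<open>T = x\<^sup>2 + (z\<^sup>2 + zw + w\<^sup>2)\<close>, which represents every \<open>m > 0\<close> with \<open>3 \<nmid> m\<close>. Indeed, let \<open>m\<close> be
  squarefree and choose a prime \<open>q \<equiv> 7 (mod 8)\<close> with \<open>q \<equiv> 1 (mod 3)\<close> and \<open>-q\<close> a square modulo each odd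
  prime divisor of \<open>m\<close>. By reciprocity \<open>m\<close> is a square modulo \<open>q\<close>, so Legendre's theorem solves
  \<open>x\<^sup>2 + q y\<^sup>2 = m z\<^sup>2\<close> and likewise \<open>u\<^sup>2 + 3 v\<^sup>2 = q t\<^sup>2\<close>. Hence \<open>T\<close> represents \<open>m\<close> rationally, and
  integrally by the Davenport--Cassels descent. Since only quadratic conditions are imposed on \<open>q\<close>,
  Dirichlet's argument is needed for real characters only; Shapiro's elementary version is used.

  If \<open>3 \<nmid> n\<close>, take \<open>y = 0\<close>. If \<open>3 | n\<close>, then \<open>y = 1\<close> works when \<open>3 \<nmid> b\<close>; for \<open>b = 3\<close> the form represents
  \<open>3k\<close> whenever it represents \<open>k\<close>; for \<open>b = 6\<close> one argues modulo 9, where the class of 3, on which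
  \<open>n - 6 y\<^sup>2\<close> is always divisible by 3, is moved by the similitude of norm 2 given by
  \<open>2 (x\<^sup>2 + z\<^sup>2 + 3 w\<^sup>2 + 6 y\<^sup>2) = (x + z)\<^sup>2 + (x - z)\<^sup>2 + 6 w\<^sup>2 + 3 (2y)\<^sup>2\<close>.
\<close>

definition eis :: "int \<Rightarrow> int \<Rightarrow> int" where
  "eis z w = z^2 + z * w + w^2"

lemma integer_sqrt:
  fixes n :: int
  assumes "n \<ge> 0"
  obtains X where "X \<ge> 0" "X^2 \<le> n" "n < (X + 1)^2"
proof
  define X where "X = \<lfloor>sqrt (real_of_int n)\<rfloor>"
  have "real_of_int X \<le> sqrt n" "sqrt n < real_of_int X + 1"
    unfolding X_def by linarith+
  moreover show "X \<ge> 0" using assms by (simp add: X_def)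
  ultimately have "real_of_int X ^ 2 \<le> sqrt n ^ 2" "sqrt n ^ 2 < (real_of_int X + 1) ^ 2"
    using assms by (intro power_mono power_strict_mono; simp)+
  hence "real_of_int (X ^ 2) \<le> real_of_int n" "real_of_int n < real_of_int ((X + 1) ^ 2)"
    using assms by simp_all
  thus "X^2 \<le> n" "n < (X + 1)^2" by linarith+
qed

subsection \<open>Rational and integral solutions\<close>

text \<open>Pigeonhole on a box with sides about sqrt(b c), sqrt c and sqrt b: two points agree in
  \<open>x - r * y\<close> modulo \<open>c\<close> and in \<open>x - s * z\<close> modulo
  \<open>b\<close>, so at their difference \<open>x^2 + b * y^2 - c * z^2\<close> is a multiple of
  \<open>b * c\<close>. The size of the box leaves only the factors -1, 0, 1, 2. Factor 0 is the
  claim, factor 1 is transformed into it, and the other two would make \<open>b\<close> a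
  square.\<close>

lemma legendre_ternary:
  fixes b c r s :: int
  assumes "b > 0" "c > 0" "coprime b c" and nsq: "\<And>k. k^2 \<noteq> b"
    and r: "c dvd r^2 + b" and s: "b dvd s^2 - c"
  obtains x y z where "z \<noteq> 0" "x^2 + b * y^2 = c * z^2"
proof -
  obtain X where X: "X \<ge> 0" "X^2 \<le> b * c" "b * c < (X + 1)^2"
    using integer_sqrt[of "b * c"] assms by auto
  obtain Y where Y: "Y \<ge> 0" "Y^2 \<le> c" "c < (Y + 1)^2"
    using integer_sqrt[of c] assms by auto
  obtain Z where Z: "Z \<ge> 0" "Z^2 \<le> b" "b < (Z + 1)^2"
    using integer_sqrt[of b] assms by auto
  define B where "B = {0..X} \<times> {0..Y} \<times> {0..Z}"
  define R where "R = {0..<c} \<times> {0..<b}"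
  define f where "f = (\<lambda>(x, y, z). ((x - r * y) mod c, (x - s * z) mod b))"
  have fB: "f ` B \<subseteq> R"
    using assms by (auto simp: f_def R_def)
  \<comment> \<open>Each side contains more lattice points than its length; the product is compared
    after squaring, which avoids real square roots.\<close>
  have "(b * c)^2 = (b * c) * (c * b)" by (simp add: power2_eq_square algebra_simps)
  also have "\<dots> < (X + 1)^2 * ((Y + 1)^2 * (Z + 1)^2)"
    using assms X Y Z by (intro mult_strict_mono) auto
  also have "\<dots> = ((X + 1) * ((Y + 1) * (Z + 1)))^2" by (simp add: power_mult_distrib)
  finally have less: "b * c < (X + 1) * ((Y + 1) * (Z + 1))"
    by (rule power_less_imp_less_base) (use X Y Z in auto)
  have "int (card R) = b * c" using assms by (simp add: R_def)
  also have "\<dots> < int (card B)" using less X Y Z by (simp add: B_def)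
  finally have "card R < card B" by simp
  hence "\<not> inj_on f B"
    using fB card_inj_on_le[of f B R] by (auto simp: R_def)
  then obtain x1 y1 z1 x2 y2 z2 where p: "(x1, y1, z1) \<in> B" "(x2, y2, z2) \<in> B"
    "(x1, y1, z1) \<noteq> (x2, y2, z2)" "f (x1, y1, z1) = f (x2, y2, z2)"
    unfolding inj_on_def by (metis prod_cases3)
  define x y z where "x = x1 - x2" and "y = y1 - y2" and "z = z1 - z2"
  have nz: "x \<noteq> 0 \<or> y \<noteq> 0 \<or> z \<noteq> 0" using p(3) by (auto simp: x_def y_def z_def)
  have dc: "c dvd x - r * y"
    using p(4) by (simp add: f_def x_def y_def mod_eq_dvd_iff algebra_simps)
  have db: "b dvd x - s * z"
    using p(4) by (simp add: f_def x_def z_def mod_eq_dvd_iff algebra_simps)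
  have "\<bar>x\<bar> \<le> X" "\<bar>y\<bar> \<le> Y" "\<bar>z\<bar> \<le> Z" using p(1,2) by (auto simp: B_def x_def y_def z_def)
  hence "x^2 \<le> X^2" "y^2 \<le> Y^2" "z^2 \<le> Z^2"
    using X Y Z by (simp_all add: abs_le_square_iff[symmetric])
  hence x: "x^2 \<le> b * c" and y: "y^2 \<le> c" and z: "z^2 \<le> b" using X Y Z by linarith+
  have yb: "b * y^2 \<le> b * c" and cz: "c * z^2 \<le> b * c"
    using y z assms by (simp_all add: mult.commute)
  define v where "v = x^2 + b * y^2 - c * z^2"
  have "v = (x - r * y) * (x + r * y) + (r^2 + b) * y^2 - c * z^2"
    by (simp add: v_def power2_eq_square algebra_simps)
  hence "c dvd v" using dc r by (metis dvd_add dvd_diff dvd_mult2 dvd_triv_left)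
  moreover have "v = (x - s * z) * (x + s * z) + (s^2 - c) * z^2 + b * y^2"
    by (simp add: v_def power2_eq_square algebra_simps)
  hence "b dvd v" using db s by (metis dvd_add dvd_mult2 dvd_triv_left)
  ultimately have "b * c dvd v" using assms by (simp add: divides_mult)
  then obtain k where k: "v = (b * c) * k" by (auto simp: dvd_def)
  have pos: "b * c > 0" using assms by simp
  have ge: "0 \<le> x^2" "0 \<le> b * y^2" "0 \<le> c * z^2" using assms by auto
  have "(b * c) * (- 1) \<le> (b * c) * k" "(b * c) * k \<le> (b * c) * 2"
    using x yb cz ge k unfolding v_def by linarith+
  hence "- 1 \<le> k" "k \<le> 2" using pos by (simp_all only: mult_le_cancel_left_pos)
  then consider "k = -1" | "k = 0" | "k = 1" | "k = 2" by linarith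
  thus ?thesis
  proof cases
    case 1
    hence "v = - (b * c)" using k by simp
    hence "c * z^2 = b * c" using cz ge unfolding v_def by linarith
    hence "c * z^2 = c * b" by (simp only: mult.commute)
    hence "z^2 = b" using assms by simp
    thus ?thesis using nsq by blast
  next
    case 2
    hence eq: "x^2 + b * y^2 = c * z^2" using k by (simp add: v_def)
    have "z \<noteq> 0"
    proof
      assume "z = 0"
      hence "x^2 + b * y^2 = 0" using eq by simp
      hence "x^2 = 0 \<and> b * y^2 = 0" using ge by linarith
      thus False using nz \<open>z = 0\<close> assms by simp
    qed
    thus ?thesis using eq that by blast
  next
    case 3
    \<comment> \<open>Since u^2 + b v^2 is multiplicative, multiplying by \<open>z^2 + b\<close>
      turns the right side into \<open>c\<close> times a square.\<close>
    hence "x^2 + b * y^2 = c * (z^2 + b)" using k by (simp add: v_def algebra_simps)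
    moreover have "(x * z + b * y)^2 + b * (y * z - x)^2 = (x^2 + b * y^2) * (z^2 + b)"
      by (simp add: power2_eq_square algebra_simps)
    ultimately have "(x * z + b * y)^2 + b * (y * z - x)^2 = c * (z^2 + b)^2"
      by (simp add: power2_eq_square)
    moreover have "z^2 + b \<noteq> 0" using assms by (smt (verit) zero_le_power2)
    ultimately show ?thesis using that by blast
  next
    case 4
    hence "v = 2 * (b * c)" using k by simp
    \<comment> \<open>The value \<open>2 * (b * c)\<close> is reached only if both positive terms
      are maximal.\<close>
    hence "x^2 = b * c" "b * y^2 = b * c" using x yb ge unfolding v_def by linarith+
    hence eq: "x^2 = b * y^2" and "y \<noteq> 0" using assms by auto
    have "y dvd x" using eq by (metis dvd_triv_right pow_divides_pow_iff zero_less_numeral)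
    then obtain t where "x = y * t" by (auto simp: dvd_def)
    hence "t^2 = b" using eq \<open>y \<noteq> 0\<close> by (simp add: power_mult_distrib)
    thus ?thesis using nsq by blast
  qed
qed

section \<open>Descent from rational to integral points\<close>

lemma centered_residue:
  fixes x t :: int
  assumes "t > 0"
  obtains X where "2 * \<bar>x - t * X\<bar> \<le> t"
proof -
  define X M where "X = (2 * x + t) div (2 * t)" and "M = (2 * x + t) mod (2 * t)"
  have "2 * x + t = 2 * (t * X) + M"
    using mult_div_mod_eq[of "2 * t" "2 * x + t"] by (simp add: X_def M_def mult.assoc)
  moreover have "0 \<le> M" "M < 2 * t" using assms by (auto simp: M_def)
  ultimately have "2 * \<bar>x - t * X\<bar> \<le> t" by (smt (verit))
  thus ?thesis using that by blast
qed

lemma eis_nonneg: "eis z w \<ge> 0" and eis_ge: "4 * eis z w \<ge> 3 * w^2" "4 * eis z w \<ge> 3 * z^2"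
proof -
  have "4 * eis z w = (2 * z + w)^2 + 3 * w^2" "4 * eis z w = (2 * w + z)^2 + 3 * z^2"
    by (simp_all add: eis_def power2_eq_square algebra_simps)
  thus "4 * eis z w \<ge> 3 * w^2" "4 * eis z w \<ge> 3 * z^2"
    using zero_le_power2[of "2 * z + w"] zero_le_power2[of "2 * w + z"] by linarith+
  thus "eis z w \<ge> 0" using zero_le_power2[of w] by linarith
qed

lemma eis_zero_iff: "eis z w = 0 \<longleftrightarrow> z = 0 \<and> w = 0"
proof
  assume "eis z w = 0"
  hence "z^2 \<le> 0" "w^2 \<le> 0" using eis_ge[where z = z and w = w] by simp_all
  thus "z = 0 \<and> w = 0" by simp
qed (simp add: eis_def)

text \<open>Strictness is essential: in the descent the third coordinate may contribute as much as
  t^2 / 4, and the total has to stay below t^2.\<close>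

lemma eis_centered_residue:
  fixes z w t :: int
  assumes "t > 0"
  obtains Z W where "4 * eis (z - t * Z) (w - t * W) < 3 * t^2"
proof -
  obtain Z where Z: "2 * \<bar>z - t * Z\<bar> \<le> t" using centered_residue assms by blast
  obtain W where W: "2 * \<bar>w - t * W\<bar> \<le> t" using centered_residue assms by blast
  define p q where "p = z - t * Z" and "q = w - t * W"
  have pq: "2 * \<bar>p\<bar> \<le> t" "2 * \<bar>q\<bar> \<le> t" using Z W by (simp_all add: p_def q_def)
  have sq: "4 * p^2 \<le> t^2" "4 * q^2 \<le> t^2"
    using power_mono[OF pq(1), of 2] power_mono[OF pq(2), of 2] by (simp_all add: power_mult_distrib)
  have am: "2 * (p * q) \<le> p^2 + q^2"
    using zero_le_power2[of "p - q"] by (simp add: power2_eq_square algebra_simps)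
  \<comment> \<open>The bound fails only if \<open>p = q = \<plusminus> t / 2\<close>, and then replacing \<open>p\<close> by \<open>-p\<close> repairs it.\<close>
  show ?thesis
  proof (cases "4 * eis p q < 3 * t^2")
    case True
    thus ?thesis using that[of Z W] by (simp add: p_def q_def)
  next
    case False
    hence "4 * p^2 = t^2" "4 * q^2 = t^2" "4 * (p * q) = t^2"
      using sq am unfolding eis_def by (smt (verit))+
    hence "4 * eis (p - t * (if p > 0 then 1 else -1)) q < 3 * t^2"
    proof -
      have *: "4 * p^2 = t^2" "4 * q^2 = t^2" "4 * (p * q) = t^2" by fact+
      have "(2 * p)^2 = t^2" using * by (simp add: power_mult_distrib)
      hence p: "2 * p = t \<or> 2 * p = - t" by (simp only: power2_eq_iff)
      hence "t * (if p > 0 then 1 else -1) = 2 * p" using assms by auto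
      hence "eis (p - t * (if p > 0 then 1 else -1)) q = p^2 - p * q + q^2"
        by (simp add: eis_def power2_eq_square)
      moreover have "t^2 > 0" using assms by simp
      ultimately show ?thesis using * by linarith
    qed
    moreover have "p - t * (if p > 0 then 1 else -1) = z - t * (Z + (if p > 0 then 1 else -1))"
      by (simp add: p_def algebra_simps)
    ultimately show ?thesis using that[of "Z + (if p > 0 then 1 else -1)" W] by (simp add: q_def)
  qed
qed

text \<open>Join the rational point (x, z, w) / T to a nearby lattice point (X, Z, W). The line
  meets the quadric of value \<open>m\<close> in a second rational point, whose denominator
  \<open>t'\<close> is the form at (x, z, w) - T (X, Z, W) divided by \<open>T\<close>, hence less
  than \<open>T\<close>.\<close>

lemma davenport_cassels:
  fixes m t x z w :: int
  assumes "t \<noteq> 0" "m * t^2 = x^2 + eis z w"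
  obtains x' z' w' where "m = x'^2 + eis z' w'"
  using assms
proof (induction "nat \<bar>t\<bar>" arbitrary: t x z w thesis rule: less_induct)
  case less
  define T where "T = \<bar>t\<bar>"
  have T: "T > 0" "m * T^2 = x^2 + eis z w" using less.prems by (simp_all add: T_def)
  obtain X where X: "2 * \<bar>x - T * X\<bar> \<le> T" using centered_residue T by blast
  obtain Z W where ZW: "4 * eis (z - T * Z) (w - T * W) < 3 * T^2"
    using eis_centered_residue T by blast
  have "4 * (x - T * X)^2 \<le> T^2"
    using power_mono[OF X, of 2] by (simp add: power_mult_distrib)
  hence lt: "(x - T * X)^2 + eis (z - T * Z) (w - T * W) < T^2" using ZW by linarith
  \<comment> \<open>\<open>d\<close> is the polar form of (x, z, w) and (X, Z, W). The second
    intersection point is a (x, z, w) + b (X, Z, W) over the denominator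
    \<open>a * T + b\<close>.\<close>
  define a where "a = X^2 + eis Z W - m"
  define d where "d = 2 * x * X + 2 * z * Z + 2 * w * W + z * W + w * Z"
  define b where "b = 2 * m * T - d"
  define t' where "t' = a * T + b"
  have eq: "(x - T * X)^2 + eis (z - T * Z) (w - T * W) = T * t'"
  proof -
    have "(x - T * X)^2 + eis (z - T * Z) (w - T * W)
            = (x^2 + eis z w) - T * d + T^2 * (X^2 + eis Z W)"
      by (simp add: eis_def d_def power2_eq_square algebra_simps)
    also have "\<dots> = m * T^2 - T * d + T^2 * (X^2 + eis Z W)" using T by simp
    also have "\<dots> = T * t'"
      by (simp add: t'_def a_def b_def power2_eq_square algebra_simps)
    finally show ?thesis .
  qed
  have nn: "0 \<le> (x - T * X)^2" "0 \<le> eis (z - T * Z) (w - T * W)" by (simp_all add: eis_nonneg)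
  have "T * 0 \<le> T * t'" using eq nn by linarith
  hence t'0: "0 \<le> t'" using T(1) by (simp add: zero_le_mult_iff)
  have "T * t' < T * T" using eq lt by (simp add: power2_eq_square)
  hence t'T: "t' < T" using T by simp
  show thesis
  proof (cases "t' = 0")
    case True
    hence "(x - T * X)^2 + eis (z - T * Z) (w - T * W) = 0" using eq by simp
    hence "(x - T * X)^2 = 0" "eis (z - T * Z) (w - T * W) = 0" using nn by linarith+
    hence "x = T * X" "z = T * Z" "w = T * W" by (simp_all add: eis_zero_iff)
    hence "m * T^2 = (X^2 + eis Z W) * T^2" using T
      by (simp add: eis_def power2_eq_square algebra_simps)
    thus thesis using T less.prems(1) by simp
  next
    case False
    have "(a * x + b * X)^2 + eis (a * z + b * Z) (a * w + b * W)
        = a^2 * (x^2 + eis z w) + a * b * d + b^2 * (X^2 + eis Z W)"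
      by (simp add: eis_def d_def power2_eq_square algebra_simps)
    also have "x^2 + eis z w = m * T^2" using T by simp
    also have "d = 2 * m * T - b" by (simp add: b_def)
    also have "X^2 + eis Z W = a + m" by (simp add: a_def)
    also have "a\<^sup>2 * (m * T\<^sup>2) + a * b * (2 * m * T - b) + b\<^sup>2 * (a + m) = m * t'^2"
      by (simp add: t'_def power2_eq_square algebra_simps)
    finally have "m * t'^2 = (a * x + b * X)^2 + eis (a * z + b * Z) (a * w + b * W)" by simp
    moreover have "nat \<bar>t'\<bar> < nat \<bar>t\<bar>" using t'0 t'T T by (simp add: T_def)
    ultimately show thesis using less.hyps less.prems(1) False by blast
  qed
qed

text \<open>One of \<open>z\<close>, \<open>w\<close>, \<open>z + w\<close> is even, and its half
  serves as \<open>q\<close>.\<close>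

lemma eis_diag:
  obtains p q where "eis z w = p^2 + 3 * q^2"
proof -
  consider (w) k where "w = 2 * k" | (z) k where "z = 2 * k" | (zw) k where "z + w = 2 * k"
    by (metis evenE odd_even_add)
  thus ?thesis
  proof cases
    case w
    hence "eis z w = (z + k)^2 + 3 * k^2" by (simp add: eis_def power2_eq_square algebra_simps)
    thus ?thesis using that by blast
  next
    case z
    hence "eis z w = (w + k)^2 + 3 * k^2" by (simp add: eis_def power2_eq_square algebra_simps)
    thus ?thesis using that by blast
  next
    case zw
    hence w: "w = 2 * k - z" by simp
    have "eis z w = (k - z)^2 + 3 * k^2" unfolding w by (simp add: eis_def power2_eq_square algebra_simps)
    thus ?thesis using that by blast
  qed
qed

lemma diag_eis: "p^2 + 3 * q^2 = eis (p - q) (2 * q)"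
  by (simp add: eis_def power2_eq_square algebra_simps)


subsection \<open>From the ternary to the quaternary forms\<close>

definition tern_rep :: "int \<Rightarrow> bool" where
  "tern_rep m \<longleftrightarrow> (\<exists>x z w. m = x^2 + eis z w)"

definition quat_rep :: "int \<Rightarrow> int \<Rightarrow> bool" where
  "quat_rep b n \<longleftrightarrow> (\<exists>x y z w. n = x^2 + b * y^2 + eis z w)"

lemma eis_scale: "eis (t * z) (t * w) = t^2 * eis z w"
  by (simp add: eis_def power2_eq_square algebra_simps)

text \<open>\<open>eis\<close> is the norm form of the Eisenstein integers; this is multiplication
  by an element of norm 3.\<close>

lemma eis_times_3: "3 * eis z w = eis (z - w) (z + 2 * w)"
  by (simp add: eis_def power2_eq_square algebra_simps)

lemma quat_repI: "tern_rep (n - b * y^2) \<Longrightarrow> quat_rep b n"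
proof -
  assume "tern_rep (n - b * y^2)"
  then obtain x z w where "n - b * y^2 = x^2 + eis z w" by (auto simp: tern_rep_def)
  hence "n = x^2 + b * y^2 + eis z w" by simp
  thus ?thesis unfolding quat_rep_def by blast
qed

lemma tern_rep_scale:
  assumes "tern_rep m"
  shows "tern_rep (t^2 * m)"
proof -
  obtain x z w where "m = x^2 + eis z w" using assms by (auto simp: tern_rep_def)
  hence "t^2 * m = (t * x)^2 + eis (t * z) (t * w)"
    by (simp add: eis_scale power_mult_distrib algebra_simps)
  thus ?thesis unfolding tern_rep_def by blast
qed

lemma quat_rep_scale:
  assumes "quat_rep b m"
  shows "quat_rep b (t^2 * m)"
proof -
  obtain x y z w where "m = x^2 + b * y^2 + eis z w" using assms by (auto simp: quat_rep_def)
  hence "t^2 * m = (t * x)^2 + b * (t * y)^2 + eis (t * z) (t * w)"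
    by (simp add: eis_scale power_mult_distrib algebra_simps)
  thus ?thesis unfolding quat_rep_def by blast
qed

text \<open>Multiplication by 3 exchanges the roles of \<open>x^2\<close> and
  \<open>3 * y^2\<close>, while \<open>eis\<close> absorbs the 3 as a norm.\<close>

lemma quat_rep_3_mult_3:
  assumes "quat_rep 3 m"
  shows "quat_rep 3 (3 * m)"
proof -
  obtain x y z w where "m = x^2 + 3 * y^2 + eis z w" using assms by (auto simp: quat_rep_def)
  hence "3 * m = (3 * y)^2 + 3 * x^2 + 3 * eis z w"
    by (simp add: power_mult_distrib algebra_simps)
  thus ?thesis unfolding quat_rep_def eis_times_3 by blast
qed

text \<open>With \<open>eis\<close> diagonalised, doubling sends the pair of unit squares to sum and
  difference and exchanges the terms with coefficients 3 and 6.\<close>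

lemma quat_rep_6_mult_2:
  assumes "quat_rep 6 m"
  shows "quat_rep 6 (2 * m)"
proof -
  obtain x y z w where "m = x^2 + 6 * y^2 + eis z w" using assms by (auto simp: quat_rep_def)
  moreover obtain p q where "eis z w = p^2 + 3 * q^2" using eis_diag by blast
  ultimately have "2 * m = (x + p)^2 + 6 * q^2 + ((x - p)^2 + 3 * (2 * y)^2)"
    by (simp add: power2_eq_square algebra_simps)
  thus ?thesis unfolding quat_rep_def diag_eis by blast
qed

text \<open>Modulo 4, a number \<^term>\<open>m\<close> that is twice an odd number is \<open>p\<^sup>2 + q\<^sup>2 + 3 w\<^sup>2\<close> only with
  \<open>p\<close>, \<open>q\<close> odd and \<open>w\<close> even, which makes the substitution integral.\<close>

lemma quat_rep_6_if_tern_rep: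
  assumes "tern_rep m" "m mod 4 = 2" "2 * n = 9 * m + 6 * (2 * y)^2"
  shows "quat_rep 6 n"
proof -
  obtain p z v where "m = p^2 + eis z v" using assms by (auto simp: tern_rep_def)
  moreover obtain q w where "eis z v = q^2 + 3 * w^2" using eis_diag by blast
  ultimately have m: "m = p^2 + q^2 + 3 * w^2" by simp
  have sq4: "k^2 mod 4 = (if even k then 0 else 1)" for k :: int
  proof (cases "even k")
    case True
    then obtain l where "k = 2 * l" by blast
    thus ?thesis by (simp add: power2_eq_square)
  next
    case False
    then obtain l where "k = 2 * l + 1" by (metis oddE)
    hence "k^2 = 1 + 4 * (l^2 + l)" by (simp add: power2_eq_square algebra_simps)
    also have "\<dots> mod 4 = 1" by (subst mod_mult_self2) simp
    finally show ?thesis using False by simp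
  qed
  have "even w \<and> odd p \<and> odd q"
  proof -
    define P Q W where "P = p^2" and "Q = q^2" and "W = w^2"
    have "(P + Q + 3 * W) mod 4 = 2" using m assms(2) by (simp add: P_def Q_def W_def)
    thus ?thesis using sq4[of p] sq4[of q] sq4[of w] unfolding P_def[symmetric] Q_def[symmetric] W_def[symmetric]
      by (cases "even p"; cases "even q"; cases "even w") (simp_all, presburger+)
  qed
  then obtain w' where w': "w = 2 * w'" and ev: "even (p + q)" by auto
  obtain s where "p + q = 2 * s" using ev by blast
  hence q: "q = 2 * s - p" by simp
  \<comment> \<open>The doubling identity is run backwards: p^2 + q^2 = 2 (s^2 + (s - p)^2), the
    even \<open>w\<close> supplies the term with coefficient 6, and the summand in \<open>y\<close>
    becomes 3 (2y)^2.\<close>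
  have "2 * n = 2 * ((3 * s)^2 + 6 * (3 * w')^2 + ((3 * (s - p))^2 + 3 * (2 * y)^2))"
    unfolding assms(3) m w' q by (simp add: power2_eq_square algebra_simps)
  hence "n = (3 * s)^2 + 6 * (3 * w')^2 + ((3 * (s - p))^2 + 3 * (2 * y)^2)" by simp
  thus ?thesis unfolding quat_rep_def diag_eis by blast
qed

text \<open>The coefficient forces \<open>y = 0\<close>, and the ternary form misses 6. The search
  is finite because \<open>eis_ge\<close> keeps \<open>z^2\<close> and \<open>w^2\<close> at most
  8.\<close>

lemma not_quat_rep_6:
  assumes "b \<ge> 7"
  shows "\<not> quat_rep b 6"
proof
  assume "quat_rep b 6"
  then obtain x y z w where eq: "6 = x^2 + b * y^2 + eis z w" by (auto simp: quat_rep_def)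
  have nn: "0 \<le> x^2" "0 \<le> b * y^2" "0 \<le> eis z w" using assms eis_nonneg by auto
  have "y = 0"
  proof (rule ccontr)
    assume "y \<noteq> 0"
    hence "y^2 \<ge> 1" by (simp add: int_one_le_iff_zero_less)
    hence "b * 1 \<le> b * y^2" using assms by (intro mult_left_mono) auto
    thus False using eq nn assms by linarith
  qed
  hence eq: "6 = x^2 + eis z w" using eq by simp
  have small: "k \<in> {-2, -1, 0, 1, 2}" if "k^2 < 9" for k :: int
    using power2_less_imp_less[of "\<bar>k\<bar>" 3] that by auto
  have "x^2 < 9" "z^2 < 9" "w^2 < 9" using eq nn(1,3) eis_ge[where z = z and w = w] by linarith+
  hence "x \<in> {-2, -1, 0, 1, 2}" "z \<in> {-2, -1, 0, 1, 2}" "w \<in> {-2, -1, 0, 1, 2}"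
    using small by blast+
  thus False using eq unfolding eis_def by (elim insertE emptyE) simp_all
qed

text \<open>Induction over the classes modulo 9: class 0 is divided by 9, class 6 is reduced to the
  ternary form by subtracting 6 or 24, and class 3 is moved to class 6 by a factor 2.\<close>

lemma quat_rep_6:
  assumes tern: "\<And>m. m > 0 \<Longrightarrow> \<not> 3 dvd m \<Longrightarrow> tern_rep m"
    and "n \<ge> 0"
  shows "quat_rep 6 n"
  using \<open>n \<ge> 0\<close>
proof (induction "nat n" arbitrary: n rule: less_induct)
  case less
  have tern_n: ?case if "tern_rep n" using that quat_repI[of n 6 0] by simp
  consider "n = 0" | "n \<noteq> 0" "\<not> 3 dvd n" | k where "n = 9 * k" "k > 0"
    | k where "n = 9 * k + 6" "k \<ge> 0" | k where "n = 9 * k + 3" "k \<ge> 0"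
  proof -
    define k where "k = n div 9"
    have "n = 9 * k + n mod 9" "k \<ge> 0" using less.prems by (simp_all add: k_def)
    moreover have "0 \<le> n mod 9" "n mod 9 < 9" by simp_all
    moreover have "3 dvd n \<longleftrightarrow> n mod 9 = 0 \<or> n mod 9 = 3 \<or> n mod 9 = 6" by presburger
    ultimately show thesis using that(1) that(2) that(3)[of k] that(4)[of k] that(5)[of k] by fastforce
  qed
  thus ?case
  proof cases
    case 1
    have "quat_rep 6 0" unfolding quat_rep_def by (intro exI[of _ 0]) (simp add: eis_def)
    thus ?thesis using 1 by simp
  next
    case 2
    thus ?thesis using tern less.prems tern_n by simp
  next
    case (3 k)
    hence "quat_rep 6 k" using less.hyps[of k] by simp
    thus ?thesis using quat_rep_scale[of 6 k 3] 3 by simp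
  next
    case (4 k)
    \<comment> \<open>\<open>y = 1\<close> leaves \<open>9 * k\<close> and \<open>y = 2\<close>
      leaves \<open>9 * (k - 2)\<close>; 3 cannot divide both cofactors.\<close>
    consider "k = 0" | "\<not> 3 dvd k" | "3 dvd k" "k > 2"
    proof -
      have "k = 0 \<or> \<not> 3 dvd k \<or> 3 dvd k \<and> k > 2" using 4(2) by presburger
      thus thesis using that by blast
    qed
    thus ?thesis
    proof cases
      case 1
      have "tern_rep 0" unfolding tern_rep_def by (intro exI[of _ 0]) (simp add: eis_def)
      thus ?thesis using quat_repI[of n 6 1] 1 4 by simp
    next
      case 2
      hence "tern_rep (3^2 * k)" using tern 4 by (intro tern_rep_scale) (auto simp: le_less)
      thus ?thesis using quat_repI[of n 6 1] 4 by simp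
    next
      case 3
      hence "\<not> 3 dvd k - 2" by presburger
      hence "tern_rep (3^2 * (k - 2))" using tern 3 by (intro tern_rep_scale) auto
      thus ?thesis using quat_repI[of n 6 2] 4 by simp
    qed
  next
    \<comment> \<open>Here 9 never divides \<open>n - 6 * y^2\<close>. An even \<open>n\<close> is
      halved; for an odd one, \<open>2 * n\<close> lies in the class of 6, and 6 (2y)^2 is
      subtracted from it.\<close>
    case (5 k)
    show ?thesis
    proof (cases "even n")
      case True
      then obtain m where "n = 2 * m" by blast
      moreover have "nat m < nat n" "m \<ge> 0" using \<open>n = 2 * m\<close> 5 by auto
      ultimately show ?thesis using less.hyps[of m] quat_rep_6_mult_2 by simp
    next
      case False
      hence ek: "even k" using 5 by simp
      \<comment> \<open>\<open>y = 1\<close> leaves 9 times \<open>2 * (k - 1)\<close> and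
        \<open>y = 2\<close> leaves 9 times \<open>2 * (k - 5)\<close>; as \<open>k\<close> is even,
        both cofactors are 2 modulo 4. For \<open>k = 0\<close> and \<open>k = 4\<close>, that is 3
        and 39, no positive cofactor prime to 3 arises, so these are represented explicitly.\<close>
      consider "k = 0" | "k = 4" | "k \<ge> 2" "\<not> 3 dvd k - 1" | "k > 5" "3 dvd k - 1"
      proof -
        have "k = 0 \<or> k = 4 \<or> k \<ge> 2 \<and> \<not> 3 dvd k - 1 \<or> k > 5 \<and> 3 dvd k - 1"
          using ek 5(2) by presburger
        thus thesis using that by blast
      qed
      thus ?thesis
      proof cases
        case 1
        have "3 = 0^2 + eis 1 1" by (simp add: eis_def)
        hence "tern_rep 3" unfolding tern_rep_def by blast
        thus ?thesis using tern_n 1 5 by simp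
      next
        case 2
        have "39 = 6^2 + eis 1 1" by (simp add: eis_def)
        hence "tern_rep 39" unfolding tern_rep_def by blast
        thus ?thesis using tern_n 2 5 by simp
      next
        case 3
        have "\<not> 3 dvd 2 * (k - 1)" using 3 by presburger
        hence "tern_rep (2 * (k - 1))" using tern 3 by simp
        moreover have "(2 * (k - 1)) mod 4 = 2" using ek by presburger
        moreover have "2 * n = 9 * (2 * (k - 1)) + 6 * (2 * 1)^2" using 5 by simp
        ultimately show ?thesis by (rule quat_rep_6_if_tern_rep)
      next
        case 4
        have "\<not> 3 dvd 2 * (k - 5)" using 4 by presburger
        hence "tern_rep (2 * (k - 5))" using tern 4 by simp
        moreover have "(2 * (k - 5)) mod 4 = 2" using ek by presburger
        moreover have "2 * n = 9 * (2 * (k - 5)) + 6 * (2 * 2)^2" using 5 by simp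
        ultimately show ?thesis by (rule quat_rep_6_if_tern_rep)
      qed
    qed
  qed
qed

lemma quat_rep_3:
  assumes tern: "\<And>m. m > 0 \<Longrightarrow> \<not> 3 dvd m \<Longrightarrow> tern_rep m"
    and "n \<ge> 0"
  shows "quat_rep 3 n"
  using \<open>n \<ge> 0\<close>
proof (induction "nat n" arbitrary: n rule: less_induct)
  case less
  consider "n = 0" | "n > 0" "\<not> 3 dvd n" | "n > 0" "3 dvd n"
    using less.prems by linarith
  thus ?case
  proof cases
    case 1
    have "quat_rep 3 0" unfolding quat_rep_def by (intro exI[of _ 0]) (simp add: eis_def)
    thus ?thesis using 1 by simp
  next
    case 2
    thus ?thesis using tern quat_repI[of n 3 0] by simp
  next
    case 3
    then obtain k where "n = 3 * k" by blast
    thus ?thesis using 3 less.hyps[of k] quat_rep_3_mult_3 by simp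
  qed
qed

text \<open>As 3 does not divide \<open>b\<close>, a multiple \<open>n\<close> of 3 leaves
  \<open>n - b\<close> prime to 3. The only multiples of 3 that may fail to exceed \<open>b\<close>
  are 0 and 3.\<close>

lemma quat_rep_1_2_4_5:
  assumes tern: "\<And>m. m > 0 \<Longrightarrow> \<not> 3 dvd m \<Longrightarrow> tern_rep m"
    and "n \<ge> 0" and b: "b \<in> {1, 2, 4, 5}"
  shows "quat_rep b n"
proof -
  consider "n = 0" | "n = 3" | "n > 0" "\<not> 3 dvd n" | "n > b" "3 dvd n" "\<not> 3 dvd n - b"
  proof -
    have "n = 0 \<or> n = 3 \<or> n > 0 \<and> \<not> 3 dvd n \<or> n > b \<and> 3 dvd n \<and> \<not> 3 dvd n - b"
      using assms(2) b by simp presburger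
    thus thesis using that by blast
  qed
  thus ?thesis
  proof cases
    case 1
    have "quat_rep b 0" unfolding quat_rep_def by (intro exI[of _ 0]) (simp add: eis_def)
    thus ?thesis using 1 by simp
  next
    case 2
    have "3 = 0^2 + b * 0^2 + eis 1 1" by (simp add: eis_def)
    thus ?thesis unfolding quat_rep_def 2 by blast
  next
    case 3
    thus ?thesis using tern quat_repI[of n b 0] by simp
  next
    case 4
    thus ?thesis using tern quat_repI[of n b 1] by simp
  qed
qed

subsection \<open>Chebyshev and Mertens estimates\<close>

text \<open>Abel summation: the partial sum over the empty interval vanishes, so there is no
  boundary term at \<open>m\<close>, and the decrements of \<open>f\<close> telescope.\<close>

lemma abs_sum_mult_decreasing_le:
  fixes a f :: "nat \<Rightarrow> real"
  assumes bound: "\<And>j. \<bar>\<Sum>n\<in>{m..<j}. a n\<bar> \<le> B"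
    and dec: "\<And>n. n \<ge> m \<Longrightarrow> f (Suc n) \<le> f n" and nonneg: "\<And>n. n \<ge> m \<Longrightarrow> 0 \<le> f n"
    and "m \<le> N"
  shows "\<bar>\<Sum>n\<in>{m..<N}. a n * f n\<bar> \<le> B * f m"
proof -
  define A where "A = (\<lambda>j. \<Sum>n\<in>{m..<j}. a n)"
  have A: "\<bar>A j\<bar> \<le> B" for j using bound by (simp add: A_def)
  have "(\<Sum>n\<in>{m..<N}. a n * f n) = A N * f N + (\<Sum>n\<in>{m..<N}. A (Suc n) * (f n - f (Suc n)))"
    using \<open>m \<le> N\<close>
  proof (induction N rule: dec_induct)
    case base
    thus ?case by (simp add: A_def)
  next
    case (step N)
    thus ?case by (simp add: A_def algebra_simps)
  qed
  also have "\<bar>\<dots>\<bar> \<le> \<bar>A N * f N\<bar> + (\<Sum>n\<in>{m..<N}. \<bar>A (Suc n) * (f n - f (Suc n))\<bar>)"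
    by (rule order_trans[OF abs_triangle_ineq]) (intro add_mono order_refl sum_abs)
  also have "\<dots> \<le> B * f N + (\<Sum>n\<in>{m..<N}. B * (f n - f (Suc n)))"
    using A dec nonneg \<open>m \<le> N\<close> unfolding abs_mult
    by (intro add_mono sum_mono mult_mono) (auto intro: order_trans[OF abs_ge_zero])
  also have "(\<Sum>n\<in>{m..<N}. B * (f n - f (Suc n))) = B * (f m - f N)"
  proof -
    have "(\<Sum>n\<in>{m..<N}. f n - f (Suc n)) = f m - f N"
      using sum_Suc_diff'[OF \<open>m \<le> N\<close>, of f] by (simp add: sum_subtractf)
    thus ?thesis by (simp only: sum_distrib_left[symmetric])
  qed
  finally show ?thesis by (simp add: algebra_simps)
qed

text \<open>Both sides run over the pairs with \<open>d * m\<close> at most \<open>N\<close>. This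
  unfolds sums of Dirichlet convolutions.\<close>

lemma sum_divisors_swap:
  fixes F :: "nat \<Rightarrow> nat \<Rightarrow> 'a :: comm_monoid_add"
  shows "(\<Sum>n\<in>{1..N}. \<Sum>d | d dvd n. F d (n div d)) = (\<Sum>d\<in>{1..N}. \<Sum>m\<in>{1..N div d}. F d m)"
proof -
  have "(\<Sum>n\<in>{1..N}. \<Sum>d | d dvd n. F d (n div d))
          = (\<Sum>(n, d)\<in>(SIGMA n:{1..N}. {d. d dvd n}). F d (n div d))"
    by (rule sum.Sigma) auto
  also have "\<dots> = (\<Sum>(d, m)\<in>(SIGMA d:{1..N}. {1..N div d}). F d m)"
    by (rule sum.reindex_bij_witness[of _ "\<lambda>(d, m). (d * m, d)" "\<lambda>(n, d). (d, n div d)"])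
       (auto simp: dvd_div_mult_self div_le_mono dvd_imp_le Suc_le_eq div_greater_zero_iff
             less_eq_div_iff_mult_less_eq mult.commute
             intro: dvd_pos_nat order_trans[OF dvd_imp_le])
  also have "\<dots> = (\<Sum>d\<in>{1..N}. \<Sum>m\<in>{1..N div d}. F d m)"
    by (rule sum.Sigma[symmetric]) auto
  finally show ?thesis .
qed

lemma real_div_bounds:
  fixes N d :: nat
  assumes "d > 0"
  shows "real (N div d) \<le> real N / real d" "real N / real d \<le> real (N div d) + 1"
proof -
  have "\<lfloor>real N / real d\<rfloor> = int (N div d)" by (rule floor_divide_of_nat_eq)
  thus "real (N div d) \<le> real N / real d" "real N / real d \<le> real (N div d) + 1" by linarith+
qed

lemma ln_Suc_le:
  assumes "n > 0"
  shows "ln (real (Suc n)) \<le> ln (real n) + 1 / real n"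
proof -
  have "real (Suc n) = real n * (1 + 1 / real n)" using assms by (simp add: field_simps)
  hence "ln (real (Suc n)) = ln (real n * (1 + 1 / real n))" by (simp only:)
  also have "\<dots> = ln (real n) + ln (1 + 1 / real n)"
  proof -
    have "1 + 1 / real n > 0" by (simp add: add_pos_nonneg)
    thus ?thesis using assms by (simp add: ln_mult)
  qed
  also have "ln (1 + 1 / real n) \<le> 1 / real n" by (rule ln_add_one_self_le_self) simp
  finally show ?thesis by simp
qed

lemma ln_le_harmonic_sum: "ln (real (Suc n)) \<le> (\<Sum>m\<in>{1..n}. 1 / real m)"
proof (induction n)
  case (Suc n)
  thus ?case using ln_Suc_le[of "Suc n"] by simp
qed simp

lemma ln_fact_eq_sum: "ln (fact N :: real) = (\<Sum>n\<in>{1..N}. ln (real n))"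
  by (induction N) (simp_all add: ln_mult)

text \<open>Legendre's formula for the factorial in logarithmic form.\<close>

lemma ln_fact_eq_mangoldt_sum: "ln (fact N :: real) = (\<Sum>d\<in>{1..N}. mangoldt d * real (N div d))"
proof -
  have "ln (fact N :: real) = (\<Sum>n\<in>{1..N}. \<Sum>d | d dvd n. mangoldt d)"
    unfolding ln_fact_eq_sum by (intro sum.cong) (simp_all add: mangoldt_sum)
  also have "\<dots> = (\<Sum>d\<in>{1..N}. \<Sum>m\<in>{1..N div d}. mangoldt d)"
    by (rule sum_divisors_swap)
  finally show ?thesis by (simp add: mult.commute)
qed

text \<open>The lower half of Mertens' first theorem: N ln N - N bounds the logarithm of the
  factorial from below, and dropping the floors in Legendre's formula bounds it from above.\<close>

lemma sum_mangoldt_over_n_ge: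
  assumes "N > 0"
  shows "(\<Sum>n\<in>{1..N}. mangoldt n / real n) \<ge> ln (real N) - 1"
proof -
  have "real N * ln (real N) - real N \<le> ln (fact N :: real)"
    using assms
  proof (induction N rule: nat_induct_non_zero)
    case (Suc n)
    have "real n * ln (real (Suc n)) \<le> real n * (ln (real n) + 1 / real n)"
      using ln_Suc_le[of n] Suc.hyps
      by (intro mult_left_mono) auto
    also have "\<dots> = real n * ln (real n) + 1" using Suc.hyps by (simp add: field_simps)
    finally have "real n * ln (real (Suc n)) \<le> real n * ln (real n) + 1" .
    moreover have "ln (fact (Suc n) :: real) = ln (fact n) + ln (real (Suc n))"
      by (simp only: ln_fact_eq_sum) simp
    moreover have "real (Suc n) * ln (real (Suc n)) = real n * ln (real (Suc n)) + ln (real (Suc n))"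
      by (simp add: algebra_simps)
    ultimately show ?case using Suc.IH by simp
  qed simp
  also have "\<dots> \<le> (\<Sum>d\<in>{1..N}. mangoldt d * (real N / real d))"
    unfolding ln_fact_eq_mangoldt_sum
    by (intro sum_mono mult_left_mono mangoldt_nonneg real_div_bounds) auto
  also have "\<dots> = real N * (\<Sum>n\<in>{1..N}. mangoldt n / real n)"
    by (simp add: sum_distrib_left mult_ac)
  finally have "real N * (ln (real N) - 1) \<le> real N * (\<Sum>n\<in>{1..N}. mangoldt n / real n)"
    by (simp add: algebra_simps)
  thus ?thesis using assms by simp
qed

text \<open>Chebyshev's argument: in the logarithm of the central binomial coefficient
  \<open>mangoldt d\<close> has the weight floor(2N/d) - 2 floor(N/d), which is nonnegative and
  equals 1 for N < d <= 2N; the coefficient itself is at most 4^N.\<close>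

lemma sum_mangoldt_doubling:
  "(\<Sum>n\<in>{1..2 * N}. mangoldt n) \<le> (\<Sum>n\<in>{1..N}. mangoldt n) + 2 * real N"
proof -
  have "(\<Sum>n\<in>{1..2 * N}. mangoldt n :: real) = (\<Sum>n\<in>{1..N}. mangoldt n) + (\<Sum>n\<in>{N<..2 * N}. mangoldt n)"
    by (subst sum.union_disjoint[symmetric]) (auto intro!: sum.cong)
  also have "(\<Sum>n\<in>{N<..2 * N}. mangoldt n :: real)
      = (\<Sum>d\<in>{N<..2 * N}. mangoldt d * (real (2 * N div d) - 2 * real (N div d)))"
  proof (intro sum.cong refl)
    fix d assume d: "d \<in> {N<..2 * N}"
    have "2 * N div d = 1" using d by (intro div_nat_eqI) auto
    thus "mangoldt d = mangoldt d * (real (2 * N div d) - 2 * real (N div d))" using d by simp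
  qed
  also have "\<dots> \<le> (\<Sum>d\<in>{1..2 * N}. mangoldt d * (real (2 * N div d) - 2 * real (N div d)))"
  proof (intro sum_mono2)
    fix d assume "d \<in> {1..2 * N} - {N<..2 * N}"
    have "2 * (N div d) \<le> 2 * N div d" by (metis div_mult2_eq div_times_less_eq_dividend less_eq_div_iff_mult_less_eq mult.assoc mult.commute div_by_0 le0 mult_0_right neq0_conv mult_le_mono2)
    hence "real (2 * (N div d)) \<le> real (2 * N div d)" by (rule of_nat_mono)
    thus "0 \<le> mangoldt d * (real (2 * N div d) - 2 * real (N div d))"
      by (intro mult_nonneg_nonneg mangoldt_nonneg) simp
  qed auto
  also have "\<dots> = ln (fact (2 * N)) - 2 * (\<Sum>d\<in>{1..2 * N}. mangoldt d * real (N div d))"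
    by (simp add: ln_fact_eq_mangoldt_sum sum_subtractf sum_distrib_left algebra_simps)
  also have "(\<Sum>d\<in>{1..2 * N}. mangoldt d * real (N div d)) = ln (fact N)"
    unfolding ln_fact_eq_mangoldt_sum by (rule sum.mono_neutral_right) auto
  also have "ln (fact (2 * N)) - 2 * ln (fact N) = ln (real (2 * N choose N))"
    by (simp add: binomial_fact ln_div ln_mult mult_2[symmetric])
  also have "\<dots> \<le> ln (2 ^ (2 * N))"
  proof (intro ln_mono)
    have "real (2 * N choose N) \<le> real (2 ^ (2 * N))"
      by (intro of_nat_mono binomial_le_pow2)
    thus "real (2 * N choose N) \<le> 2 ^ (2 * N)" by simp
  qed (auto simp: zero_less_binomial_iff)
  also have "\<dots> \<le> 2 * real N"
    using ln_le_minus_one[of 2] by (simp add: ln_realpow mult_left_le)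
  finally show ?thesis by simp
qed

text \<open>Halving \<open>N\<close> repeatedly. For odd \<open>N\<close> the one additional term is
  at most ln N, which the slack between 2 and 4 absorbs.\<close>

lemma sum_mangoldt_le: "(\<Sum>n\<in>{1..N}. mangoldt n) \<le> 4 * real N"
proof (induction N rule: less_induct)
  case (less N)
  show ?case
  proof (cases "N = 0")
    case False
    define M where "M = N div 2"
    have IH: "(\<Sum>n\<in>{1..M}. mangoldt n) \<le> 4 * real M" using False by (intro less) (simp add: M_def)
    show ?thesis
    proof (cases "even N")
      case True
      hence "N = 2 * M" by (simp add: M_def)
      thus ?thesis using sum_mangoldt_doubling[of M] IH by simp
    next
      case False
      hence N: "N = Suc (2 * M)" by (simp add: M_def)
      have "mangoldt N \<le> ln (real N)" using N by (intro mangoldt_le) simp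
      also have "\<dots> \<le> real N - 1" using N by (intro ln_le_minus_one) simp
      finally have "mangoldt (Suc (2 * M)) \<le> 2 * real M" using N by simp
      thus ?thesis using sum_mangoldt_doubling[of M] IH by (simp add: N)
    qed
  qed simp
qed

section \<open>Sums of reciprocal square roots\<close>

definition inv_sqrt_sum :: "nat \<Rightarrow> real" where "inv_sqrt_sum N = (\<Sum>n\<in>{1..N}. 1 / sqrt (real n))"

text \<open>Each increment of 2 sqrt lies between consecutive reciprocal roots. So
  \<open>inv_sqrt_sum M\<close> minus 2 sqrt M varies by at most the difference of the end terms,
  and no limiting constant has to be introduced.\<close>

lemma inv_sqrt_sum_increment:
  assumes "0 < N" "N \<le> M"
  shows "2 * sqrt (real M) - 2 * sqrt (real N) + (1 / sqrt (real M) - 1 / sqrt (real N)) \<le> inv_sqrt_sum M - inv_sqrt_sum N"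
    and "inv_sqrt_sum M - inv_sqrt_sum N \<le> 2 * sqrt (real M) - 2 * sqrt (real N)"
proof -
  have "2 * sqrt (real M) - 2 * sqrt (real N) + (1 / sqrt (real M) - 1 / sqrt (real N)) \<le> inv_sqrt_sum M - inv_sqrt_sum N
        \<and> inv_sqrt_sum M - inv_sqrt_sum N \<le> 2 * sqrt (real M) - 2 * sqrt (real N)"
    using assms(2)
  proof (induction M rule: dec_induct)
    case (step M)
    define x y where "x = sqrt (real M)" and "y = sqrt (real (Suc M))"
    have xy: "0 < x" "x \<le> y" "y^2 - x^2 = 1" using step assms by (auto simp: x_def y_def)
    hence "(y - x) * (y + x) = 1" by (simp add: power2_eq_square algebra_simps)
    hence d: "y - x = 1 / (y + x)" using xy by (simp add: field_simps)
    have "1 / y \<le> 2 * (1 / (y + x))" "2 * (1 / (y + x)) \<le> 1 / x"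
      using xy by (auto simp: field_simps)
    hence "1 / y \<le> 2 * y - 2 * x" "2 * y - 2 * x \<le> 1 / x"
      unfolding right_diff_distrib[symmetric] d by simp_all
    moreover have "inv_sqrt_sum (Suc M) = inv_sqrt_sum M + 1 / y" by (simp add: inv_sqrt_sum_def y_def)
    ultimately show ?case using step.IH unfolding x_def y_def by linarith
  qed simp
  thus "2 * sqrt (real M) - 2 * sqrt (real N) + (1 / sqrt (real M) - 1 / sqrt (real N)) \<le> inv_sqrt_sum M - inv_sqrt_sum N"
    and "inv_sqrt_sum M - inv_sqrt_sum N \<le> 2 * sqrt (real M) - 2 * sqrt (real N)" by auto
qed

lemma inv_sqrt_sum_bounds:
  assumes "N > 0"
  shows "2 * sqrt (real N) - 2 \<le> inv_sqrt_sum N" "inv_sqrt_sum N \<le> 2 * sqrt (real N)"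
proof -
  have "inv_sqrt_sum 1 = 1" "0 \<le> 1 / sqrt (real N)" by (simp_all add: inv_sqrt_sum_def)
  thus "2 * sqrt (real N) - 2 \<le> inv_sqrt_sum N" "inv_sqrt_sum N \<le> 2 * sqrt (real N)"
    using inv_sqrt_sum_increment[of 1 N] assms unfolding of_nat_1 real_sqrt_one by linarith+
qed

lemma inv_sqrt_sum_mono: "M \<le> N \<Longrightarrow> inv_sqrt_sum M \<le> inv_sqrt_sum N"
  unfolding inv_sqrt_sum_def by (intro sum_mono2) auto

lemma inv_sqrt_sum_nonneg: "inv_sqrt_sum N \<ge> 0"
  unfolding inv_sqrt_sum_def by (intro sum_nonneg) auto

subsection \<open>Nonprincipal real characters\<close>

text \<open>A real Dirichlet character modulo \<open>k\<close>, extended by 0. Nonprincipality is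
  stated through a value -1, the form in which it cancels the sum over a period.\<close>

locale real_character =
  fixes \<chi> :: "nat \<Rightarrow> real" and k :: nat
  assumes k_pos: "k > 0"
    and mult: "\<chi> (m * n) = \<chi> m * \<chi> n"
    and vals: "\<chi> n \<in> {-1, 0, 1}"
    and nonzero_iff: "\<chi> n \<noteq> 0 \<longleftrightarrow> coprime n k"
    and periodic: "\<chi> (n mod k) = \<chi> n"
    and nonprincipal: "\<exists>a. \<chi> a = -1"
begin

lemma abs_le_1: "\<bar>\<chi> n\<bar> \<le> 1"
  using vals[of n] by auto

lemma char_1: "\<chi> 1 = 1"
proof -
  have "\<chi> 1 * \<chi> 1 = \<chi> 1" using mult[of 1 1] by simp
  moreover have "\<chi> 1 \<noteq> 0" by (simp add: nonzero_iff)
  ultimately show ?thesis by simp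
qed

lemma power: "\<chi> (n ^ j) = \<chi> n ^ j"
  by (induction j) (simp_all add: mult char_1[simplified])

text \<open>Multiplication by an \<open>a\<close> with value -1 permutes the residues and negates
  the sum.\<close>

lemma sum_period: "(\<Sum>n<k. \<chi> n) = 0"
proof -
  obtain a where a: "\<chi> a = -1" using nonprincipal by blast
  hence cop: "coprime a k" using nonzero_iff[of a] by simp
  have "inj_on (\<lambda>n. a * n mod k) {..<k}"
  proof (rule inj_onI)
    fix x y assume xy: "x \<in> {..<k}" "y \<in> {..<k}" "a * x mod k = a * y mod k"
    hence "[a * x = a * y] (mod k)" by (simp add: cong_def)
    hence "[x = y] (mod k)" using cop by (simp add: cong_mult_lcancel_nat coprime_commute)
    thus "x = y" using xy by (simp add: cong_def)
  qed
  moreover have "(\<lambda>n. a * n mod k) ` {..<k} \<subseteq> {..<k}" using k_pos by auto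
  ultimately have "bij_betw (\<lambda>n. a * n mod k) {..<k} {..<k}"
    by (simp add: bij_betw_def endo_inj_surj)
  hence "(\<Sum>n<k. \<chi> n) = (\<Sum>n<k. \<chi> (a * n mod k))"
    by (rule sum.reindex_bij_betw[symmetric])
  also have "\<dots> = - (\<Sum>n<k. \<chi> n)" by (simp add: periodic mult a sum_negf)
  finally show ?thesis by simp
qed

lemma abs_partial_sum_le: "\<bar>\<Sum>n<N. \<chi> n\<bar> \<le> real k"
proof -
  have "(\<Sum>n<N. \<chi> n) = (\<Sum>n<N mod k. \<chi> n)"
  proof (induction N rule: less_induct)
    case (less N)
    show ?case
    proof (cases "N < k")
      case False
      then obtain M where N: "N = k + M" using le_Suc_ex not_less by blast
      have "(\<Sum>n<k + M. \<chi> n) = (\<Sum>n<k. \<chi> n) + (\<Sum>n<M. \<chi> (k + n))"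
        by (induction M) simp_all
      also have "(\<Sum>n<M. \<chi> (k + n)) = (\<Sum>n<M. \<chi> n)"
        using periodic by (intro sum.cong refl) (metis mod_add_self1)
      finally show ?thesis using less[of M] k_pos by (simp add: sum_period N)
    qed simp
  qed
  also have "\<bar>\<dots>\<bar> \<le> (\<Sum>n<N mod k. 1)"
    by (rule order_trans[OF sum_abs]) (intro sum_mono abs_le_1)
  also have "\<dots> \<le> real k" using k_pos by (simp add: less_imp_le)
  finally show ?thesis .
qed

text \<open>A sum over an interval is a difference of two initial sums, each bounded by
  \<open>k\<close>.\<close>

definition B :: real where "B = 2 * real k"

lemma B_nonneg: "B \<ge> 0"
  by (simp add: B_def)

lemma abs_sum_le: "\<bar>\<Sum>n\<in>{m..<N}. \<chi> n\<bar> \<le> B"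
proof (cases "m \<le> N")
  case True
  have "(\<Sum>n<N. \<chi> n) = (\<Sum>n<m. \<chi> n) + (\<Sum>n\<in>{m..<N}. \<chi> n)"
    using True by (subst sum.union_disjoint[symmetric]) (auto intro!: sum.cong)
  thus ?thesis using abs_partial_sum_le[of N] abs_partial_sum_le[of m] by (simp add: B_def)
qed (use B_nonneg in simp)

lemma abs_sum_mult_le:
  assumes "\<And>n. n \<ge> m \<Longrightarrow> f (Suc n) \<le> f n" "\<And>n. n \<ge> m \<Longrightarrow> 0 \<le> f n"
  shows "\<bar>\<Sum>n\<in>{m..N}. \<chi> n * f n\<bar> \<le> B * f m"
proof (cases "m \<le> N")
  case True
  thus ?thesis
    using abs_sum_mult_decreasing_le[where a = \<chi> and m = m and B = B and f = f and N = "Suc N"] abs_sum_le assms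
    by (simp add: atLeastLessThanSuc_atLeastAtMost)
qed (use B_nonneg assms in simp)

definition L_partial :: "nat \<Rightarrow> real" where "L_partial N = (\<Sum>n\<in>{1..N}. \<chi> n / real n)"

lemma L_partial_diff:
  assumes "N \<le> N'"
  shows "\<bar>L_partial N' - L_partial N\<bar> \<le> B / (real N + 1)"
proof -
  have "L_partial N' - L_partial N = (\<Sum>n\<in>{Suc N..N'}. \<chi> n * (1 / real n))"
    unfolding L_partial_def using assms
    by (subst sum_diff[symmetric]) (auto intro!: sum.cong)
  also have "\<bar>\<dots>\<bar> \<le> B * (1 / real (Suc N))"
    by (rule abs_sum_mult_le) (auto simp: field_simps)
  finally show ?thesis by (simp add: add.commute)
qed

text \<open>The limit is L(1, \<chi>). The explicit rate is used both for its nonvanishing and for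
  the Mertens-type bound.\<close>

lemma L_partial_limit:
  obtains L where "\<And>N. \<bar>L_partial N - L\<bar> \<le> B / (real N + 1)"
proof -
  have lim0: "(\<lambda>N. B / (real N + 1)) \<longlonglongrightarrow> 0"
    using LIMSEQ_Suc[OF lim_const_over_n[of B]] by (simp add: add.commute)
  have "Cauchy L_partial"
  proof (rule CauchyI')
    fix e :: real assume "e > 0"
    hence "\<forall>\<^sub>F N in sequentially. B / (real N + 1) < e / 2"
      by (intro order_tendstoD(2)[OF lim0]) simp
    then obtain M where M: "B / (real M + 1) < e / 2"
      by (auto simp: eventually_sequentially)
    have "\<bar>L_partial m - L_partial n\<bar> < e" if "m \<ge> M" "n > m" for m n
    proof -
      have "\<bar>L_partial m - L_partial M\<bar> < e / 2" "\<bar>L_partial n - L_partial M\<bar> < e / 2"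
        using L_partial_diff[of M m] L_partial_diff[of M n] M that by linarith+
      thus ?thesis by linarith
    qed
    thus "\<exists>M. \<forall>m\<ge>M. \<forall>n>m. dist (L_partial m) (L_partial n) < e" by (auto simp: dist_real_def)
  qed
  then obtain L where L: "L_partial \<longlonglongrightarrow> L" using real_Cauchy_convergent convergent_def by blast
  have "\<bar>L_partial N - L\<bar> \<le> B / (real N + 1)" for N
  proof (rule LIMSEQ_le_const2)
    show "(\<lambda>N'. \<bar>L_partial N - L_partial N'\<bar>) \<longlonglongrightarrow> \<bar>L_partial N - L\<bar>"
      by (intro tendsto_intros L)
    show "\<exists>N0. \<forall>n\<ge>N0. \<bar>L_partial N - L_partial n\<bar> \<le> B / (real N + 1)"
      using L_partial_diff by (metis abs_minus_commute)
  qed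
  thus ?thesis using that by blast
qed


section \<open>Nonvanishing of L(1, \<chi>)\<close>

lemma divisor_sum_coprime_mult:
  assumes "coprime m n" "m > 0" "n > 0"
  shows "(\<Sum>d | d dvd m * n. \<chi> d) = (\<Sum>d | d dvd m. \<chi> d) * (\<Sum>d | d dvd n. \<chi> d)"
proof -
  have gcds: "gcd m (d * e) = d" "gcd n (d * e) = e" if "d dvd m" "e dvd n" for d e
  proof -
    have "coprime d n" "coprime e m"
      using that assms(1) by (auto intro: coprime_divisors coprime_imp_coprime dvd_trans)
    have "gcd m (d * e) = gcd m d"
      using \<open>coprime e m\<close> by (intro gcd_mult_right_right_cancel) (simp add: coprime_commute)
    moreover have "gcd n (d * e) = gcd n e"
      using \<open>coprime d n\<close> by (intro gcd_mult_right_left_cancel) (simp add: coprime_commute)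
    ultimately show "gcd m (d * e) = d" "gcd n (d * e) = e" using that by simp_all
  qed
  have "(\<Sum>d | d dvd m. \<chi> d) * (\<Sum>d | d dvd n. \<chi> d)
          = (\<Sum>(d, e)\<in>{d. d dvd m} \<times> {e. e dvd n}. \<chi> (d * e))"
    by (simp add: sum_product sum.cartesian_product mult)
  also have "\<dots> = (\<Sum>d | d dvd m * n. \<chi> d)"
  proof (rule sum.reindex_bij_witness[of _ "\<lambda>d. (gcd m d, gcd n d)" "\<lambda>(d, e). d * e"])
    fix p assume "p \<in> {d. d dvd m} \<times> {e. e dvd n}"
    then obtain d e where p: "p = (d, e)" "d dvd m" "e dvd n" by auto
    thus "(\<lambda>d. (gcd m d, gcd n d)) ((\<lambda>(d, e). d * e) p) = p"
      and "(\<lambda>(d, e). d * e) p \<in> {d. d dvd m * n}" using gcds by (auto intro: mult_dvd_mono)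
  next
    fix d assume "d \<in> {d. d dvd m * n}"
    then obtain d1 d2 where "d = d1 * d2" "d1 dvd m" "d2 dvd n"
      using division_decomp[of d m n] by auto
    thus "(\<lambda>(d, e). d * e) (gcd m d, gcd n d) = d" using gcds by simp
  qed auto
  finally show ?thesis by simp
qed

text \<open>The sum is geometric with ratio 0, 1 or -1; only the last ratio can give 0, and then
  only for odd exponents.\<close>

lemma divisor_sum_primepow:
  assumes "prime p"
  shows "(\<Sum>d | d dvd p ^ j. \<chi> d) \<ge> 0" and "even j \<Longrightarrow> (\<Sum>d | d dvd p ^ j. \<chi> d) \<ge> 1"
proof -
  have "{d. d dvd p ^ j} = (\<lambda>i. p ^ i) ` {..j}"
    using divides_primepow_nat[OF assms] by auto
  moreover have "inj_on (\<lambda>i. p ^ i) {..j}"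
    using prime_gt_1_nat[OF assms] by (auto simp: inj_on_def)
  ultimately have "(\<Sum>d | d dvd p ^ j. \<chi> d) = (\<Sum>i\<le>j. \<chi> p ^ i)"
    by (simp add: sum.reindex power)
  moreover have "(\<Sum>i\<le>j. \<chi> p ^ i) \<ge> (if even j then 1 else 0)"
  proof -
    consider "\<chi> p = 0" | "\<chi> p = 1" | "\<chi> p = -1" using vals[of p] by auto
    thus ?thesis
    proof cases
      case 3
      have "(\<Sum>i\<le>j. (-1 :: real) ^ i) = (if even j then 1 else 0)" by (induction j) auto
      thus ?thesis using 3 by simp
    qed (simp_all add: power_0_left)
  qed
  ultimately show "(\<Sum>d | d dvd p ^ j. \<chi> d) \<ge> 0" and "even j \<Longrightarrow> (\<Sum>d | d dvd p ^ j. \<chi> d) \<ge> 1"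
    by (auto split: if_splits)
qed

text \<open>Multiplicativity reduces this to prime powers, and the exponents in a square are
  even.\<close>

lemma divisor_sum_nonneg_and_square:
  assumes "n > 0"
  shows "(\<Sum>d | d dvd n. \<chi> d) \<ge> 0 \<and> (\<Sum>d | d dvd n ^ 2. \<chi> d) \<ge> 1"
  using assms
proof (induction n rule: less_induct)
  case (less n)
  show ?case
  proof (cases "n = 1")
    case True
    thus ?thesis using char_1 by simp
  next
    case False
    then obtain p where p: "prime p" "p dvd n" using prime_factor_nat by blast
    obtain m where m: "n = p ^ multiplicity p n * m" "\<not> p dvd m"
      using multiplicity_decompose'[of n p] p less.prems not_prime_unit by (metis less_numeral_extra(3))
    define j where "j = multiplicity p n"
    have n: "n = p ^ j * m" using m by (simp add: j_def)
    have "j > 0" using p less.prems by (simp add: j_def prime_multiplicity_gt_zero_iff)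
    have "m > 0" using n less.prems by (cases m) auto
    have "1 < p ^ j" using prime_gt_1_nat[OF p(1)] \<open>j > 0\<close> by (rule one_less_power)
    hence "m < n" using n \<open>m > 0\<close> by simp
    note IH = less.IH[OF \<open>m < n\<close> \<open>m > 0\<close>]
    have cop: "coprime p m" using p m(2) by (simp add: prime_imp_coprime)
    have "(\<Sum>d | d dvd n. \<chi> d) = (\<Sum>d | d dvd p ^ j. \<chi> d) * (\<Sum>d | d dvd m. \<chi> d)"
      unfolding n using cop \<open>m > 0\<close> p by (intro divisor_sum_coprime_mult) (auto simp: prime_gt_0_nat)
    moreover have "n ^ 2 = p ^ (2 * j) * m ^ 2"
      by (simp add: n power_mult_distrib power_mult[symmetric] mult.commute)
    hence "(\<Sum>d | d dvd n ^ 2. \<chi> d) = (\<Sum>d | d dvd p ^ (2 * j). \<chi> d) * (\<Sum>d | d dvd m ^ 2. \<chi> d)"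
      using cop \<open>m > 0\<close> p by (simp only:, intro divisor_sum_coprime_mult) (auto simp: prime_gt_0_nat)
    moreover have "1 * 1 \<le> (\<Sum>d | d dvd p ^ (2 * j). \<chi> d) * (\<Sum>d | d dvd m ^ 2. \<chi> d)"
      using IH divisor_sum_primepow[OF p(1), of "2 * j"] by (intro mult_mono) auto
    ultimately show ?thesis using IH divisor_sum_primepow(1)[OF p(1), of j] by simp
  qed
qed

text \<open>The sum of \<open>r(n) / sqrt n\<close> over \<open>n \<le> K\<^sup>2\<close>, where \<open>r(n) = (\<Sum>d | d dvd n. \<chi> d)\<close>, is at least the
  harmonic sum up to \<open>K\<close> by positivity of \<open>r\<close>; the hyperbola method with cut at \<open>d = K\<close> would
  bound it if \<open>L\<close> vanished.\<close>

lemma L_nonzero: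
  assumes L: "\<And>N. \<bar>L_partial N - L\<bar> \<le> B / (real N + 1)"
  shows "L \<noteq> 0"
proof
  assume "L = 0"
  \<comment> \<open>The bound adds 2B for the divisors beyond \<open>K\<close> to 2B, 2B and 4 for
    the three parts of the sum up to \<open>K\<close>.\<close>
  have upper: "(\<Sum>m\<in>{1..K}. 1 / real m) \<le> 6 * B + 4" if "K > 0" for K
  proof -
    define N where "N = K ^ 2"
    have N: "N > 0" "sqrt (real N) = real K" using that by (auto simp: N_def)
    define R where "R = (\<Sum>n\<in>{1..N}. (\<Sum>d | d dvd n. \<chi> d) / sqrt (real n))"
    have "(\<Sum>m\<in>{1..K}. 1 / real m) = (\<Sum>m\<in>{1..K}. 1 / sqrt (real (m ^ 2)))"
      by simp
    also have "\<dots> \<le> (\<Sum>m\<in>{1..K}. (\<Sum>d | d dvd m ^ 2. \<chi> d) / sqrt (real (m ^ 2)))"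
      using divisor_sum_nonneg_and_square by (intro sum_mono divide_right_mono) auto
    also have "\<dots> = (\<Sum>n\<in>(\<lambda>m. m ^ 2) ` {1..K}. (\<Sum>d | d dvd n. \<chi> d) / sqrt (real n))"
      by (subst sum.reindex) (auto simp: inj_on_def)
    also have "\<dots> \<le> R"
      unfolding R_def using divisor_sum_nonneg_and_square
      by (intro sum_mono2) (auto simp: N_def power_mono)
    finally have lower: "(\<Sum>m\<in>{1..K}. 1 / real m) \<le> R" .
    have "R = (\<Sum>n\<in>{1..N}. \<Sum>d | d dvd n. (\<chi> d / sqrt (real d)) * (1 / sqrt (real (n div d))))"
      unfolding R_def
    proof (intro sum.cong refl)
      fix n assume n: "n \<in> {1..N}"
      have "\<chi> d / sqrt (real n) = (\<chi> d / sqrt (real d)) * (1 / sqrt (real (n div d)))" if "d dvd n" for d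
        using that n by (elim dvdE) (simp add: real_sqrt_mult)
      thus "(\<Sum>d | d dvd n. \<chi> d) / sqrt (real n)
              = (\<Sum>d | d dvd n. (\<chi> d / sqrt (real d)) * (1 / sqrt (real (n div d))))"
        unfolding sum_divide_distrib by (intro sum.cong) auto
    qed
    also have "\<dots> = (\<Sum>d\<in>{1..N}. \<chi> d / sqrt (real d) * inv_sqrt_sum (N div d))"
      unfolding inv_sqrt_sum_def sum_distrib_left
      by (rule sum_divisors_swap[where F = "\<lambda>d m. \<chi> d / sqrt (real d) * (1 / sqrt (real m))"])
    also have "\<dots> = (\<Sum>d\<in>{1..K}. \<chi> d / sqrt (real d) * inv_sqrt_sum (N div d))
                  + (\<Sum>d\<in>{Suc K..N}. \<chi> d * (inv_sqrt_sum (N div d) / sqrt (real d)))"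
    proof -
      have "K \<le> N" by (simp add: N_def power2_eq_square)
      hence "{1..N} = {1..K} \<union> {Suc K..N}" by auto
      thus ?thesis by (simp add: sum.union_disjoint)
    qed
    finally have R: "R = (\<Sum>d\<in>{1..K}. \<chi> d / sqrt (real d) * inv_sqrt_sum (N div d))
                  + (\<Sum>d\<in>{Suc K..N}. \<chi> d * (inv_sqrt_sum (N div d) / sqrt (real d)))" .
    \<comment> \<open>For d > K the weight decreases in \<open>d\<close>, so Abel summation applies;
      its first value is at most 2 because N div (K + 1) <= K + 1.\<close>
    have large: "\<bar>\<Sum>d\<in>{Suc K..N}. \<chi> d * (inv_sqrt_sum (N div d) / sqrt (real d))\<bar> \<le> 2 * B"
    proof -
      have "\<bar>\<Sum>d\<in>{Suc K..N}. \<chi> d * (inv_sqrt_sum (N div d) / sqrt (real d))\<bar>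
              \<le> B * (inv_sqrt_sum (N div Suc K) / sqrt (real (Suc K)))"
      proof (rule abs_sum_mult_le)
        fix n assume "n \<ge> Suc K"
        thus "inv_sqrt_sum (N div Suc n) / sqrt (real (Suc n)) \<le> inv_sqrt_sum (N div n) / sqrt (real n)"
          by (intro frac_le inv_sqrt_sum_nonneg inv_sqrt_sum_mono div_le_mono2) auto
      qed (auto simp: inv_sqrt_sum_nonneg)
      also have "\<dots> \<le> B * 2"
      proof (intro mult_left_mono B_nonneg)
        have "inv_sqrt_sum (N div Suc K) \<le> 2 * sqrt (real (N div Suc K))"
          using inv_sqrt_sum_bounds(2)[of "N div Suc K"] by (cases "N div Suc K = 0") (auto simp: inv_sqrt_sum_def)
        also have "\<dots> \<le> 2 * sqrt (real (Suc K))"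
        proof -
          have "N div Suc K \<le> Suc K * Suc K div Suc K"
            by (intro div_le_mono) (simp add: N_def power2_eq_square)
          also have "\<dots> = Suc K" by (rule nonzero_mult_div_cancel_left) simp
          finally show ?thesis by (simp del: of_nat_Suc)
        qed
        finally show "inv_sqrt_sum (N div Suc K) / sqrt (real (Suc K)) \<le> 2"
          by (simp add: pos_divide_le_eq)
      qed
      finally show ?thesis by simp
    qed
    \<comment> \<open>For d <= K the inner sum is 2 sqrt(N/d) + u + E d, where 2 sqrt(N/d) equals 2
      K / sqrt d. The offset \<open>u\<close> does not depend on \<open>d\<close>, so it multiplies
      a plain character sum.\<close>
    define u where "u = inv_sqrt_sum N - 2 * sqrt (real N)"
    define E where "E = (\<lambda>d. inv_sqrt_sum (N div d) - 2 * real K / sqrt (real d) - u)"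
    have E: "\<bar>E d\<bar> \<le> 2 / sqrt (real K)" if d: "d \<in> {1..K}" for d
    proof -
      define M where "M = N div d"
      have "K \<le> M" using d \<open>K > 0\<close> by (simp add: M_def N_def power2_eq_square less_eq_div_iff_mult_less_eq)
      have "M \<le> N" by (simp add: M_def)
      have "M > 0" using \<open>K \<le> M\<close> \<open>K > 0\<close> by simp
      define x y where "x = sqrt (real M)" and "y = sqrt (real N / real d)"
      have "real M \<le> real N / real d" unfolding M_def
        using d by (intro real_div_bounds) simp
      moreover have "real N / real d \<le> real M + 1" unfolding M_def
        using d by (intro real_div_bounds) simp
      ultimately have xy: "0 < x" "x \<le> y" "y^2 - x^2 \<le> 1"
        using \<open>M > 0\<close> by (auto simp: x_def y_def)
      have "(y - x) * (2 * x) \<le> (y - x) * (y + x)" using xy by (intro mult_left_mono) auto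
      also have "\<dots> \<le> 1" using xy by (simp add: power2_eq_square algebra_simps)
      finally have yx: "2 * y - 2 * x \<le> 1 / x" using xy by (simp add: field_simps)
      have "y = real K / sqrt (real d)" using N by (simp add: y_def real_sqrt_divide)
      hence "E d = (inv_sqrt_sum M - 2 * x - u) + (2 * x - 2 * y)" by (simp add: E_def M_def)
      moreover have "0 \<le> inv_sqrt_sum M - 2 * x - u" "inv_sqrt_sum M - 2 * x - u \<le> 1 / x"
        using inv_sqrt_sum_increment[OF \<open>M > 0\<close> \<open>M \<le> N\<close>] N(1) unfolding u_def x_def
        by (simp_all add: algebra_simps) (smt (verit) divide_nonneg_nonneg real_sqrt_ge_zero of_nat_0_le_iff)
      ultimately have "\<bar>E d\<bar> \<le> 2 * (1 / x)" using yx xy by linarith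
      also have "1 / x \<le> 1 / sqrt (real K)"
        using \<open>K \<le> M\<close> \<open>K > 0\<close> by (simp add: x_def frac_le)
      finally show ?thesis by simp
    qed
    have "(\<Sum>d\<in>{1..K}. \<chi> d / sqrt (real d) * inv_sqrt_sum (N div d))
        = (\<Sum>d\<in>{1..K}. 2 * real K * (\<chi> d / real d) + u * (\<chi> d * (1 / sqrt (real d))) + \<chi> d / sqrt (real d) * E d)"
    proof (intro sum.cong refl)
      fix d assume "d \<in> {1..K}"
      hence "sqrt (real d) * sqrt (real d) = real d" "sqrt (real d) > 0" by simp_all
      thus "\<chi> d / sqrt (real d) * inv_sqrt_sum (N div d)
        = 2 * real K * (\<chi> d / real d) + u * (\<chi> d * (1 / sqrt (real d))) + \<chi> d / sqrt (real d) * E d"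
        by (simp add: E_def field_simps)
    qed
    also have "\<dots> = 2 * real K * L_partial K + u * (\<Sum>d\<in>{1..K}. \<chi> d * (1 / sqrt (real d)))
                   + (\<Sum>d\<in>{1..K}. \<chi> d / sqrt (real d) * E d)"
      by (simp only: sum.distrib sum_distrib_left L_partial_def)
    finally have small: "(\<Sum>d\<in>{1..K}. \<chi> d / sqrt (real d) * inv_sqrt_sum (N div d)) = \<dots>" .
    \<comment> \<open>Here the assumption \<open>L = 0\<close> enters: the rate of convergence
      compensates the factor \<open>K\<close>.\<close>
    have 1: "\<bar>2 * real K * L_partial K\<bar> \<le> 2 * B"
    proof -
      have "\<bar>L_partial K\<bar> \<le> B / (real K + 1)" using L[of K] \<open>L = 0\<close> by simp
      hence "(real K + 1) * \<bar>L_partial K\<bar> \<le> B"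
        by (simp add: pos_le_divide_eq mult.commute)
      moreover have "real K * \<bar>L_partial K\<bar> \<le> (real K + 1) * \<bar>L_partial K\<bar>" by (intro mult_right_mono) auto
      ultimately show ?thesis by (simp add: abs_mult)
    qed
    have 2: "\<bar>u * (\<Sum>d\<in>{1..K}. \<chi> d * (1 / sqrt (real d)))\<bar> \<le> 2 * B"
    proof -
      have "\<bar>\<Sum>d\<in>{1..K}. \<chi> d * (1 / sqrt (real d))\<bar> \<le> B * (1 / sqrt (real 1))"
        by (rule abs_sum_mult_le) (auto simp: frac_le)
      moreover have "\<bar>u\<bar> \<le> 2" using inv_sqrt_sum_bounds[OF N(1)] by (simp add: u_def)
      ultimately have "\<bar>u\<bar> * \<bar>\<Sum>d\<in>{1..K}. \<chi> d * (1 / sqrt (real d))\<bar> \<le> 2 * B"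
        by (intro mult_mono) auto
      thus ?thesis by (simp only: abs_mult)
    qed
    have 3: "\<bar>\<Sum>d\<in>{1..K}. \<chi> d / sqrt (real d) * E d\<bar> \<le> 4"
    proof -
      have "\<bar>\<Sum>d\<in>{1..K}. \<chi> d / sqrt (real d) * E d\<bar> \<le> (\<Sum>d\<in>{1..K}. 1 / sqrt (real d) * (2 / sqrt (real K)))"
      proof (intro order_trans[OF sum_abs] sum_mono)
        fix d assume d: "d \<in> {1..K}"
        have "\<bar>\<chi> d / sqrt (real d)\<bar> \<le> 1 / sqrt (real d)"
          using abs_le_1[of d] by (simp add: divide_right_mono)
        thus "\<bar>\<chi> d / sqrt (real d) * E d\<bar> \<le> 1 / sqrt (real d) * (2 / sqrt (real K))"
          unfolding abs_mult using E[OF d] by (intro mult_mono) auto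
      qed
      also have "\<dots> = inv_sqrt_sum K * (2 / sqrt (real K))" by (simp only: inv_sqrt_sum_def sum_distrib_right)
      also have "\<dots> \<le> 2 * sqrt (real K) * (2 / sqrt (real K))"
        using inv_sqrt_sum_bounds(2)[OF \<open>K > 0\<close>] by (intro mult_right_mono) auto
      also have "\<dots> = 4" using \<open>K > 0\<close> by simp
      finally show ?thesis .
    qed
    show ?thesis using lower R small large 1 2 3 by linarith
  qed
  obtain n :: nat where n: "real n > exp (6 * B + 4)" using reals_Archimedean2 by blast
  hence "n > 0" by (metis exp_gt_zero gr0I of_nat_0 order.asym)
  have "ln (exp (6 * B + 4)) < ln (real n)"
    using n \<open>n > 0\<close> by (subst ln_less_cancel_iff) auto
  hence "6 * B + 4 < ln (real n)" by simp
  also have "\<dots> \<le> ln (real (Suc n))" using \<open>n > 0\<close> by simp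
  also have "\<dots> \<le> 6 * B + 4" using ln_le_harmonic_sum[of n] upper[OF \<open>n > 0\<close>] by linarith
  finally show False by simp
qed

section \<open>Mertens sums twisted by a character\<close>

lemma abs_sum_ln_le: "\<bar>\<Sum>n\<in>{1..N}. \<chi> n * (ln (real n) / real n)\<bar> \<le> 2 + B"
proof -
  \<comment> \<open>The quotient ln n / n decreases from 3 on, where ln n >= 1; the term at 2 is
    split off, and the term at 1 is 0.\<close>
  have dec: "ln (real (Suc n)) / real (Suc n) \<le> ln (real n) / real n" if "n \<ge> 3" for n
  proof -
    have "real n * ln (real (Suc n)) \<le> real n * (ln (real n) + 1 / real n)"
      using ln_Suc_le[of n] that
      by (intro mult_left_mono) auto
    also have "\<dots> = real n * ln (real n) + 1" using that by (simp add: field_simps)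
    also have "1 \<le> ln (real n)"
      using that exp_le by (subst ln_ge_iff) (auto intro: order_trans)
    finally show ?thesis using that by (simp add: field_simps)
  qed
  have tail: "\<bar>\<Sum>n\<in>{3..N}. \<chi> n * (ln (real n) / real n)\<bar> \<le> B * (ln (real 3) / real 3)"
    by (rule abs_sum_mult_le) (use dec in auto)
  also have "\<dots> \<le> B * 1"
    using B_nonneg ln_le_minus_one[of 3] by (intro mult_left_mono) auto
  finally have tail: "\<bar>\<Sum>n\<in>{3..N}. \<chi> n * (ln (real n) / real n)\<bar> \<le> B" by simp
  have term2: "\<bar>\<chi> 2 * (ln (real 2) / real 2)\<bar> \<le> 1 * 1"
    unfolding abs_mult using abs_le_1 ln_le_minus_one[of 2] by (intro mult_mono) auto
  consider "N = 0" | "N = 1" | "N \<ge> 2" by linarith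
  thus ?thesis
  proof cases
    case 3
    hence "{1..N} = insert 1 (insert 2 {3..N})" by auto
    thus ?thesis using tail term2 by simp
  qed (use B_nonneg in auto)
qed

text \<open>Write ln as the divisor sum of \<open>mangoldt\<close>: the bounded sum of \<chi>(n) ln
  n / n becomes the wanted sum with weights \<open>L_partial (N div d)\<close>. Replacing these by
  \<open>L\<close> costs a bounded error, and one divides by \<open>L\<close>.\<close>

theorem bounded_sum_mangoldt:
  obtains C where "\<And>N. \<bar>\<Sum>n\<in>{1..N}. \<chi> n * (mangoldt n / real n)\<bar> \<le> C"
proof -
  obtain L where L: "\<And>N. \<bar>L_partial N - L\<bar> \<le> B / (real N + 1)" using L_partial_limit by blast
  have "L \<noteq> 0" using L by (rule L_nonzero)
  have "\<bar>\<Sum>n\<in>{1..N}. \<chi> n * (mangoldt n / real n)\<bar> \<le> (2 + 5 * B) / \<bar>L\<bar>" for N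
  proof (cases "N = 0")
    case False
    have "(\<Sum>n\<in>{1..N}. \<chi> n * (ln (real n) / real n))
        = (\<Sum>n\<in>{1..N}. \<Sum>d | d dvd n. \<chi> d * (mangoldt d / real d) * (\<chi> (n div d) / real (n div d)))"
    proof (intro sum.cong refl)
      fix n assume n: "n \<in> {1..N}"
      have "\<chi> n * (mangoldt d / real n) = \<chi> d * (mangoldt d / real d) * (\<chi> (n div d) / real (n div d))"
        if "d dvd n" for d
        using that n by (elim dvdE) (simp add: mult)
      hence "(\<Sum>d | d dvd n. \<chi> n * (mangoldt d / real n))
          = (\<Sum>d | d dvd n. \<chi> d * (mangoldt d / real d) * (\<chi> (n div d) / real (n div d)))"
        by (intro sum.cong) auto
      moreover have "ln (real n) = (\<Sum>d | d dvd n. mangoldt d)" using n by (simp add: mangoldt_sum)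
      ultimately show "\<chi> n * (ln (real n) / real n)
          = (\<Sum>d | d dvd n. \<chi> d * (mangoldt d / real d) * (\<chi> (n div d) / real (n div d)))"
        by (simp add: sum_distrib_left sum_divide_distrib)
    qed
    also have "\<dots> = (\<Sum>d\<in>{1..N}. \<chi> d * (mangoldt d / real d) * L_partial (N div d))"
      unfolding L_partial_def sum_distrib_left
      by (rule sum_divisors_swap[where F = "\<lambda>d m. \<chi> d * (mangoldt d / real d) * (\<chi> m / real m)"])
    also have "\<dots> = L * (\<Sum>d\<in>{1..N}. \<chi> d * (mangoldt d / real d))
        + (\<Sum>d\<in>{1..N}. \<chi> d * (mangoldt d / real d) * (L_partial (N div d) - L))"
      unfolding sum_distrib_left sum.distrib[symmetric]
      by (intro sum.cong refl) (simp add: right_diff_distrib diff_divide_distrib mult.commute)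
    finally have eq: "L * (\<Sum>d\<in>{1..N}. \<chi> d * (mangoldt d / real d))
        = (\<Sum>n\<in>{1..N}. \<chi> n * (ln (real n) / real n))
        - (\<Sum>d\<in>{1..N}. \<chi> d * (mangoldt d / real d) * (L_partial (N div d) - L))" by simp
    \<comment> \<open>The deviation from \<open>L\<close> is at most B d / N. The factor
      \<open>d\<close> cancels, and Chebyshev's bound finishes.\<close>
    have "\<bar>\<Sum>d\<in>{1..N}. \<chi> d * (mangoldt d / real d) * (L_partial (N div d) - L)\<bar>
        \<le> (\<Sum>d\<in>{1..N}. B / real N * mangoldt d)"
    proof (intro order_trans[OF sum_abs] sum_mono)
      fix d assume d: "d \<in> {1..N}"
      have "real N / real d \<le> real (N div d) + 1"
        using d by (intro real_div_bounds) simp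
      hence "B / (real (N div d) + 1) \<le> B / (real N / real d)"
        using B_nonneg d by (intro divide_left_mono) auto
      hence "\<bar>L_partial (N div d) - L\<bar> \<le> B / (real N / real d)" using L order_trans by blast
      moreover have "\<bar>\<chi> d * (mangoldt d / real d)\<bar> \<le> 1 * (mangoldt d / real d)"
        unfolding abs_mult using abs_le_1 by (intro mult_mono) (auto simp: mangoldt_nonneg)
      ultimately have "\<bar>\<chi> d * (mangoldt d / real d) * (L_partial (N div d) - L)\<bar>
          \<le> (1 * (mangoldt d / real d)) * (B / (real N / real d))"
        unfolding abs_mult[of "\<chi> d * (mangoldt d / real d)"]
        by (intro mult_mono) (auto simp: mangoldt_nonneg)
      also have "\<dots> = B / real N * mangoldt d" using d by simp
      finally show "\<bar>\<chi> d * (mangoldt d / real d) * (L_partial (N div d) - L)\<bar> \<le> B / real N * mangoldt d" .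
    qed
    also have "\<dots> = B / real N * (\<Sum>d\<in>{1..N}. mangoldt d)" by (simp add: sum_distrib_left)
    also have "\<dots> \<le> B / real N * (4 * real N)"
      using B_nonneg by (intro mult_left_mono sum_mangoldt_le) auto
    also have "\<dots> = 4 * B" using False by simp
    finally have "\<bar>L * (\<Sum>d\<in>{1..N}. \<chi> d * (mangoldt d / real d))\<bar> \<le> 2 + 5 * B"
      unfolding eq using abs_sum_ln_le[of N] by linarith
    thus ?thesis using \<open>L \<noteq> 0\<close> by (simp add: abs_mult pos_le_divide_eq mult.commute)
  qed (use B_nonneg in simp)
  thus ?thesis using that by blast
qed

end

section \<open>Several real characters at a prime\<close>

lemma sum_mangoldt_coprime_ge:
  fixes k :: nat
  assumes "k > 0"
  obtains C where
    "\<And>N. N > 0 \<Longrightarrow> ln (real N) - C \<le> (\<Sum>n\<in>{1..N}. if coprime n k then mangoldt n / real n else 0)"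
proof
  fix N :: nat assume "N > 0"
  let ?P = "prime_factors k"
  let ?g = "\<lambda>n. mangoldt n / real n :: real"
  \<comment> \<open>The excluded terms are powers of the finitely many primes dividing
    \<open>k\<close>; for each such \<open>p\<close> they form a geometric series of ratio at most
    1/2, contributing at most ln p.\<close>
  define A where "A = {n\<in>{1..N}. \<not> coprime n k \<and> primepow n}"
  have "(\<Sum>n\<in>{1..N}. if coprime n k then 0 else ?g n) = sum ?g A"
    by (intro sum.mono_neutral_cong_right) (auto simp: A_def mangoldt_def)
  also have "\<dots> \<le> sum ?g ((\<lambda>(p, j). p ^ j) ` (?P \<times> {1..N}))"
  proof (intro sum_mono2)
    show "A \<subseteq> (\<lambda>(p, j). p ^ j) ` (?P \<times> {1..N})"
    proof
      fix n assume n: "n \<in> A"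
      then obtain p j where pj: "prime p" "j > 0" "n = p ^ j"
        by (auto simp: A_def primepow_def)
      have "p dvd k"
      proof (rule ccontr)
        assume "\<not> p dvd k"
        hence "coprime (p ^ j) k" using pj by (simp add: prime_imp_coprime)
        thus False using n pj by (simp add: A_def)
      qed
      moreover have "j \<le> p ^ j"
        using less_exp[of j] power_mono[of 2 p j] prime_ge_2_nat[OF pj(1)] by simp
      ultimately show "n \<in> (\<lambda>(p, j). p ^ j) ` (?P \<times> {1..N})"
        using pj n assms by (auto simp: A_def in_prime_factors_iff intro!: image_eqI[of _ _ "(p, j)"])
    qed
  qed (auto simp: mangoldt_nonneg)
  also have "\<dots> \<le> (\<Sum>(p, j)\<in>?P \<times> {1..N}. ?g (p ^ j))"
    by (rule order_trans[OF sum_image_le]) (auto simp: mangoldt_nonneg case_prod_beta)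
  also have "\<dots> = (\<Sum>p\<in>?P. \<Sum>j\<in>{1..N}. ?g (p ^ j))"
    by (simp add: sum.cartesian_product)
  also have "\<dots> \<le> (\<Sum>p\<in>?P. ln (real p))"
  proof (intro sum_mono)
    fix p assume "p \<in> ?P"
    hence p: "prime p" "p \<ge> 2" by (auto simp: in_prime_factors_iff prime_ge_2_nat)
    have "(\<Sum>j\<in>{1..N}. ?g (p ^ j)) = (\<Sum>j\<in>{1..N}. ln (real p) * (1 / real p) ^ j)"
      using p by (intro sum.cong) (simp_all add: power_one_over divide_inverse power_inverse)
    also have "\<dots> \<le> (\<Sum>j\<in>{1..N}. ln (real p) * (1 / 2) ^ j)"
      using p by (intro sum_mono mult_left_mono power_mono) (auto simp: field_simps)
    also have "\<dots> = ln (real p) * (1 - (1 / 2) ^ N)"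
    proof -
      have "(\<Sum>j\<in>{1..N}. (1 / 2 :: real) ^ j) = 1 - (1 / 2) ^ N"
        by (induction N) simp_all
      thus ?thesis by (simp only: sum_distrib_left[symmetric])
    qed
    also have "\<dots> \<le> ln (real p) * 1"
      using p by (intro mult_left_mono) auto
    finally show "(\<Sum>j\<in>{1..N}. ?g (p ^ j)) \<le> ln (real p)" by simp
  qed
  finally have "(\<Sum>n\<in>{1..N}. if coprime n k then 0 else ?g n) \<le> (\<Sum>p\<in>?P. ln (real p))" .
  moreover have "sum ?g {1..N} = (\<Sum>n\<in>{1..N}. if coprime n k then ?g n else 0)
                               + (\<Sum>n\<in>{1..N}. if coprime n k then 0 else ?g n)"
    unfolding sum.distrib[symmetric] by (intro sum.cong) auto
  ultimately show "ln (real N) - (1 + (\<Sum>p\<in>?P. ln (real p)))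
      \<le> (\<Sum>n\<in>{1..N}. if coprime n k then ?g n else 0)"
    using sum_mangoldt_over_n_ge[OF \<open>N > 0\<close>] by linarith
qed

text \<open>Expanding \<open>\<Prod>i\<in>I. \<epsilon> i * \<chi> i n + 1\<close> and weighting with \<open>mangoldt n / n\<close>, only the empty
  product contributes an unbounded sum, so some prime power \<open>p ^ j\<close> has the prescribed values. The
  value \<open>\<epsilon> i0 = -1\<close> forces \<open>j\<close> to be odd, so that \<open>p\<close> itself has them as well.\<close>

theorem prime_with_prescribed_characters:
  fixes \<chi> :: "'i \<Rightarrow> nat \<Rightarrow> real" and \<epsilon> :: "'i \<Rightarrow> real"
  assumes "finite I" "k > 0"
    and mult: "\<And>i m n. i \<in> I \<Longrightarrow> \<chi> i (m * n) = \<chi> i m * \<chi> i n"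
    and vals: "\<And>i n. i \<in> I \<Longrightarrow> coprime n k \<Longrightarrow> \<chi> i n \<in> {-1, 1}"
    and per: "\<And>i n. i \<in> I \<Longrightarrow> \<chi> i (n mod k) = \<chi> i n"
    and indep: "\<And>S. S \<subseteq> I \<Longrightarrow> S \<noteq> {} \<Longrightarrow> \<exists>a. coprime a k \<and> (\<Prod>i\<in>S. \<chi> i a) = -1"
    and eps: "\<And>i. i \<in> I \<Longrightarrow> \<epsilon> i \<in> {-1, 1}" and neg: "i0 \<in> I" "\<epsilon> i0 = -1"
  obtains q where "prime q" "\<And>i. i \<in> I \<Longrightarrow> \<chi> i q = \<epsilon> i"
proof -
  \<comment> \<open>Products of the characters over subsets, set to 0 off the units. Independence
    makes each nonempty product nonprincipal, so its twisted Mertens sum is bounded.\<close>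
  define \<psi> where "\<psi> = (\<lambda>S n. if coprime n k then \<Prod>i\<in>S. \<chi> i n else 0)"
  define F where "F = (\<lambda>n. if coprime n k then \<Prod>i\<in>I. \<epsilon> i * \<chi> i n + 1 else 0)"
  have F: "F n = (\<Sum>S\<in>Pow I. (\<Prod>i\<in>S. \<epsilon> i) * \<psi> S n)" for n
    by (simp add: F_def \<psi>_def prod_add[OF \<open>finite I\<close>] prod.distrib)
  have char: "real_character (\<psi> S) k" if S: "S \<subseteq> I" "S \<noteq> {}" for S
  proof
    have val: "(\<Prod>i\<in>S. \<chi> i n) \<in> {-1, 1}" if "coprime n k" for n
      using finite_subset[OF S(1) \<open>finite I\<close>] S(1)
    proof (induction S rule: finite_induct)
      case (insert i S)
      thus ?case using vals[of i n] that by auto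
    qed simp
    show "k > 0" by fact
    show "\<psi> S (m * n) = \<psi> S m * \<psi> S n" for m n
    proof -
      have "(\<Prod>i\<in>S. \<chi> i (m * n)) = (\<Prod>i\<in>S. \<chi> i m) * (\<Prod>i\<in>S. \<chi> i n)"
        unfolding prod.distrib[symmetric] using S mult by (intro prod.cong) auto
      thus ?thesis by (simp add: \<psi>_def coprime_mult_left_iff)
    qed
    show "\<psi> S n \<in> {-1, 0, 1}" for n
      using val[of n] by (auto simp: \<psi>_def)
    show "\<psi> S n \<noteq> 0 \<longleftrightarrow> coprime n k" for n
      using val[of n] by (auto simp: \<psi>_def)
    show "\<psi> S (n mod k) = \<psi> S n" for n
    proof -
      have "(\<Prod>i\<in>S. \<chi> i (n mod k)) = (\<Prod>i\<in>S. \<chi> i n)"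
        using S per by (intro prod.cong) auto
      moreover have "coprime (n mod k) k \<longleftrightarrow> coprime n k"
        using \<open>k > 0\<close> by (simp add: coprime_mod_left_iff)
      ultimately show ?thesis by (simp add: \<psi>_def)
    qed
    show "\<exists>a. \<psi> S a = -1" using indep[OF S] by (auto simp: \<psi>_def)
  qed
  obtain C where C: "\<And>S N. S \<in> Pow I - {{}} \<Longrightarrow> \<bar>\<Sum>n\<in>{1..N}. \<psi> S n * (mangoldt n / real n)\<bar> \<le> C S"
  proof -
    have "\<forall>S\<in>Pow I - {{}}. \<exists>C. \<forall>N. \<bar>\<Sum>n\<in>{1..N}. \<psi> S n * (mangoldt n / real n)\<bar> \<le> C"
      using real_character.bounded_sum_mangoldt[OF char] by (metis DiffD1 DiffD2 PowD singletonI)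
    thus thesis using that by metis
  qed
  obtain C0 where C0: "\<And>N. N > 0 \<Longrightarrow>
      ln (real N) - C0 \<le> (\<Sum>n\<in>{1..N}. if coprime n k then mangoldt n / real n else 0)"
    using sum_mangoldt_coprime_ge \<open>k > 0\<close> by blast
  have "\<exists>n. F n * mangoldt n \<noteq> 0"
  proof (rule ccontr)
    assume contra: "\<nexists>n. F n * mangoldt n \<noteq> 0"
    have upper: "ln (real N) \<le> C0 + (\<Sum>S\<in>Pow I - {{}}. C S)" if "N > 0" for N
    proof -
      define T where "T = (\<lambda>S. (\<Prod>i\<in>S. \<epsilon> i) * (\<Sum>n\<in>{1..N}. \<psi> S n * (mangoldt n / real n)))"
      have "0 = (\<Sum>n\<in>{1..N}. F n * (mangoldt n / real n))"
      proof -
        have "F n * (mangoldt n / real n) = 0" for n using contra by auto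
        thus ?thesis by (simp only: sum.neutral_const)
      qed
      also have "\<dots> = (\<Sum>n\<in>{1..N}. \<Sum>S\<in>Pow I. (\<Prod>i\<in>S. \<epsilon> i) * (\<psi> S n * (mangoldt n / real n)))"
        unfolding F sum_distrib_right by (simp add: mult.assoc)
      also have "\<dots> = sum T (Pow I)"
        unfolding T_def sum_distrib_left by (rule sum.swap)
      also have "\<dots> = T {} + sum T (Pow I - {{}})"
        using \<open>finite I\<close> by (intro sum.remove) auto
      finally have "T {} = - sum T (Pow I - {{}})" by simp
      also have "\<dots> \<le> (\<Sum>S\<in>Pow I - {{}}. \<bar>T S\<bar>)"
        using sum_abs[of T "Pow I - {{}}"] by linarith
      also have "\<dots> \<le> (\<Sum>S\<in>Pow I - {{}}. C S)"
      proof (intro sum_mono)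
        fix S assume S: "S \<in> Pow I - {{}}"
        have "\<bar>\<Prod>i\<in>S. \<epsilon> i\<bar> = (\<Prod>i\<in>S. 1)"
          unfolding abs_prod
        proof (intro prod.cong refl)
          fix i assume "i \<in> S"
          hence "i \<in> I" using S by blast
          thus "\<bar>\<epsilon> i\<bar> = 1" using eps[of i] by auto
        qed
        thus "\<bar>T S\<bar> \<le> C S" using C[OF S] by (simp add: T_def abs_mult)
      qed
      finally have "T {} \<le> (\<Sum>S\<in>Pow I - {{}}. C S)" .
      moreover have "T {} = (\<Sum>n\<in>{1..N}. if coprime n k then mangoldt n / real n else 0)"
        by (auto simp: T_def \<psi>_def intro!: sum.cong)
      ultimately show ?thesis using C0[OF that] by linarith
    qed
    obtain n :: nat where n: "real n > exp (C0 + (\<Sum>S\<in>Pow I - {{}}. C S))"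
      using reals_Archimedean2 by blast
    hence "n > 0" by (metis exp_gt_zero gr0I of_nat_0 order.asym)
    have "ln (exp (C0 + (\<Sum>S\<in>Pow I - {{}}. C S))) < ln (real n)"
      using n \<open>n > 0\<close> by (subst ln_less_cancel_iff) auto
    hence "C0 + (\<Sum>S\<in>Pow I - {{}}. C S) < ln (real n)" by simp
    thus False using upper[OF \<open>n > 0\<close>] by simp
  qed
  then obtain n where n: "F n \<noteq> 0" "mangoldt n \<noteq> (0 :: real)" by auto
  hence cop: "coprime n k" by (auto simp: F_def split: if_splits)
  have "primepow n" using n by (auto simp: mangoldt_def split: if_splits)
  then obtain p j where pj: "prime p" "j > 0" "n = p ^ j" by (auto simp: primepow_def)
  have copp: "coprime p k" using cop pj by simp
  have pow: "\<chi> i (p ^ j) = \<chi> i p ^ j" if "i \<in> I" for i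
  proof -
    have "\<chi> i (p ^ Suc l) = \<chi> i p ^ Suc l" for l
    proof (induction l)
      case (Suc l)
      have "\<chi> i (p ^ Suc (Suc l)) = \<chi> i p * \<chi> i (p ^ Suc l)"
        using mult[OF that, of p "p ^ Suc l"] by simp
      thus ?case using Suc by simp
    qed simp
    thus ?thesis using \<open>j > 0\<close> by (metis Suc_pred)
  qed
  have eq: "\<chi> i n = \<epsilon> i" if "i \<in> I" for i
  proof -
    have "\<epsilon> i * \<chi> i n + 1 \<noteq> 0" using n cop that \<open>finite I\<close> by (auto simp: F_def)
    thus ?thesis using vals[OF that cop] eps[OF that] by auto
  qed
  have "odd j"
  proof
    assume "even j"
    hence "\<chi> i0 p ^ j = 1" using vals[OF neg(1) copp] by auto
    thus False using eq[OF neg(1)] pow[OF neg(1)] neg(2) pj by simp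
  qed
  hence "\<chi> i p = \<epsilon> i" if "i \<in> I" for i
    using eq[OF that] pow[OF that] pj vals[OF that copp] by auto
  thus ?thesis using that pj(1) by blast
qed

subsection \<open>Primes with prescribed Legendre symbols\<close>

lemma Legendre_values: "Legendre a p \<in> {-1, 0, 1}"
  by (simp add: Legendre_def)

lemma Legendre_cong:
  assumes "[a = b] (mod p)"
  shows "Legendre a p = Legendre b p"
proof -
  have "[a = 0] (mod p) \<longleftrightarrow> [b = 0] (mod p)" "QuadRes p a \<longleftrightarrow> QuadRes p b"
    using assms unfolding QuadRes_def by (blast intro: cong_trans cong_sym)+
  thus ?thesis by (simp add: Legendre_def)
qed

text \<open>Signs differ by at most 2, less than \<open>p\<close>. This turns Euler's criterion into
  equations between Legendre symbols.\<close>

lemma sign_eq_if_cong: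
  fixes x y :: int
  assumes "x \<in> {-1, 0, 1}" "y \<in> {-1, 0, 1}" "[x = y] (mod int p)" "p > 2"
  shows "x = y"
proof -
  have "int p dvd x - y" using assms by (simp add: cong_iff_dvd_diff)
  moreover have "\<bar>x - y\<bar> < int p" using assms by auto
  ultimately show ?thesis using zdvd_imp_le[of "int p" "\<bar>x - y\<bar>"] by (cases "x = y") auto
qed

lemma Legendre_mult:
  assumes "prime p" "p > 2"
  shows "Legendre (a * b) (int p) = Legendre a (int p) * Legendre b (int p)"
proof (rule sign_eq_if_cong)
  show "[Legendre (a * b) (int p) = Legendre a (int p) * Legendre b (int p)] (mod int p)"
    using euler_criterion[OF assms, of "a * b"]
      cong_mult[OF euler_criterion[OF assms, of a] euler_criterion[OF assms, of b]]
    by (metis cong_sym cong_trans power_mult_distrib)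
  show "Legendre a (int p) * Legendre b (int p) \<in> {-1, 0, 1}"
    using Legendre_values[of a "int p"] Legendre_values[of b "int p"] by auto
qed (use assms Legendre_values in auto)

lemma Legendre_minus_1:
  assumes "prime p" "p > 2"
  shows "Legendre (-1) (int p) = (-1) ^ ((p - 1) div 2)"
proof (rule sign_eq_if_cong)
  show "[Legendre (-1) (int p) = (-1) ^ ((p - 1) div 2)] (mod int p)"
    by (rule euler_criterion[OF assms])
  show "(-1 :: int) ^ ((p - 1) div 2) \<in> {-1, 0, 1}" by (cases "even ((p - 1) div 2)") auto
qed (use assms Legendre_values in auto)

lemma Legendre_eq_0_iff: "Legendre a p = 0 \<longleftrightarrow> p dvd a"
  by (simp add: Legendre_def cong_0_iff)

lemma Legendre_1:
  assumes "prime p"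
  shows "Legendre 1 (int p) = 1"
proof -
  have "\<not> [1 = 0] (mod int p)" using prime_gt_1_nat[OF assms] by (simp add: cong_0_iff)
  moreover have "QuadRes (int p) 1" unfolding QuadRes_def by (rule exI[of _ 1]) simp
  ultimately show ?thesis by (simp add: Legendre_def)
qed

lemma Legendre_eq_1D:
  assumes "Legendre a p = 1"
  obtains y where "p dvd y^2 - a"
  using assms by (auto simp: Legendre_def QuadRes_def cong_iff_dvd_diff split: if_splits)

text \<open>Squaring modulo \<open>p\<close> identifies 1 and \<open>p - 1\<close>, so on a finite
  set it is not surjective either.\<close>

lemma nonresidue_exists:
  assumes "prime p" "p > 2"
  obtains r :: nat where "Legendre (int r) (int p) = -1"
proof -
  define f where "f = (\<lambda>x. x^2 mod p)"
  have "(p - 1)^2 mod p = 1"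
  proof -
    have "(p - 1)^2 = 1 + (p - 2) * p"
    proof -
      obtain j where "p = j + 2" using assms by (metis add.commute le_Suc_ex less_imp_le)
      thus ?thesis by (simp add: power2_eq_square algebra_simps)
    qed
    hence "(p - 1)^2 mod p = (1 + (p - 2) * p) mod p" by (simp only:)
    also have "\<dots> = 1 mod p" by (rule mod_mult_self1)
    finally show ?thesis using assms by simp
  qed
  hence "f (p - 1) = f 1" using assms by (simp add: f_def)
  have "\<not> inj_on f {..<p}"
  proof
    assume "inj_on f {..<p}"
    hence "p - 1 = 1" using \<open>f (p - 1) = f 1\<close> assms inj_onD[of f "{..<p}" "p - 1" 1] by simp
    thus False using assms by simp
  qed
  moreover have "f ` {..<p} \<subseteq> {..<p}" using assms by (auto simp: f_def)
  ultimately have "f ` {..<p} \<noteq> {..<p}" using eq_card_imp_inj_on[of "{..<p}" f] by auto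
  then obtain r where r: "r < p" "r \<notin> f ` {..<p}" using \<open>f ` {..<p} \<subseteq> {..<p}\<close> by auto
  have "\<not> QuadRes (int p) (int r)"
  proof
    assume "QuadRes (int p) (int r)"
    then obtain y where y: "[y^2 = int r] (mod int p)" by (auto simp: QuadRes_def)
    define x where "x = nat (y mod int p)"
    have x: "int x = y mod int p" using assms by (simp add: x_def)
    have "int (x^2 mod p) = int r"
      using y r by (simp add: x zmod_int power_mod cong_def)
    moreover have "x < p" using x assms by (simp add: x_def nat_less_iff)
    ultimately show False using r by (auto simp: f_def)
  qed
  moreover have "r \<noteq> 0"
  proof
    assume "r = 0"
    hence "r = f 0" by (simp add: f_def)
    thus False using r by auto
  qed
  hence "\<not> [int r = 0] (mod int p)" using r by (auto simp: cong_0_iff dest: zdvd_imp_le)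
  ultimately have "Legendre (int r) (int p) = -1" by (simp add: Legendre_def)
  thus ?thesis using that by blast
qed

text \<open>Gauss's lemma: with q = 8j + 7, the doubles exceeding (q - 1) / 2 come from 2j + 2, ...,
  4j + 3, an even number of elements.\<close>

lemma Legendre_2:
  assumes "prime q" "q mod 8 = 7"
  shows "Legendre 2 (int q) = 1"
proof -
  obtain j where j: "q = 8 * j + 7" using assms(2) by (metis mult_div_mod_eq)
  interpret GAUSS q 2
    using assms j by unfold_locales (auto simp: cong_0_iff dest: zdvd_imp_le)
  have half: "(int q - 1) div 2 = 4 * int j + 3" using j by simp
  hence "A = {0<..4 * int j + 3}" unfolding A_def by (simp only:)
  hence B: "B = (\<lambda>x. 2 * x) ` {0<..4 * int j + 3}"
    by (simp only: B_def mult.commute)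
  have "(\<lambda>x. x mod int q) ` B = id ` B"
    unfolding B using j by (intro image_cong) auto
  hence "E = (\<lambda>x. 2 * x) ` {0<..4 * int j + 3} \<inter> {4 * int j + 3<..}"
    by (simp only: E_def C_def half B image_id id_apply)
  also have "\<dots> = (\<lambda>x. 2 * x) ` {2 * int j + 2..4 * int j + 3}" by auto
  finally have "E = (\<lambda>x. 2 * x) ` {2 * int j + 2..4 * int j + 3}" .
  hence "card E = card {2 * int j + 2..4 * int j + 3}"
    by (simp add: card_image inj_on_def)
  also have "\<dots> = 2 * (j + 1)" by simp
  finally show ?thesis using gauss_lemma by simp
qed

text \<open>The indices 4 and 8 stand for the two independent characters modulo 8; every other index is
  meant to be an odd prime.\<close>

definition chi :: "nat \<Rightarrow> nat \<Rightarrow> int" where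
  "chi i n = (if i = 4 then (if n mod 4 = 1 then 1 else if n mod 4 = 3 then -1 else 0)
     else if i = 8 then (if n mod 8 \<in> {1, 7} then 1 else if n mod 8 \<in> {3, 5} then -1 else 0)
     else Legendre (int n) (int i))"

lemma chi_mult:
  assumes "i \<in> {4, 8} \<or> prime i \<and> i > 2"
  shows "chi i (m * n) = chi i m * chi i n"
proof -
  consider "i = 4" | "i = 8" | "prime i" "i > 2" "i \<noteq> 4" "i \<noteq> 8"
    using assms by blast
  thus ?thesis
  proof cases
    case 1
    define a b where "a = m mod 4" and "b = n mod 4"
    have "a < 4" "b < 4" by (simp_all add: a_def b_def)
    hence "a \<in> {0, 1, 2, 3}" "b \<in> {0, 1, 2, 3}" unfolding insert_iff empty_iff by presburger+
    hence "chi 4 (a * b) = chi 4 a * chi 4 b"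
      unfolding chi_def by (elim insertE emptyE) simp_all
    moreover have "m * n mod 4 = a * b mod 4" by (simp add: a_def b_def mod_mult_eq)
    hence "chi 4 (m * n) = chi 4 (a * b)" "chi 4 m = chi 4 a" "chi 4 n = chi 4 b"
      by (simp_all add: chi_def a_def b_def)
    ultimately show ?thesis unfolding 1 by (simp only:)
  next
    case 2
    define a b where "a = m mod 8" and "b = n mod 8"
    have "a < 8" "b < 8" by (simp_all add: a_def b_def)
    hence "a \<in> {0, 1, 2, 3, 4, 5, 6, 7}" "b \<in> {0, 1, 2, 3, 4, 5, 6, 7}" unfolding insert_iff empty_iff by presburger+
    hence "chi 8 (a * b) = chi 8 a * chi 8 b"
      unfolding chi_def by (elim insertE emptyE) simp_all
    moreover have "m * n mod 8 = a * b mod 8" by (simp add: a_def b_def mod_mult_eq)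
    hence "chi 8 (m * n) = chi 8 (a * b)" "chi 8 m = chi 8 a" "chi 8 n = chi 8 b"
      by (simp_all add: chi_def a_def b_def)
    ultimately show ?thesis unfolding 2 by (simp only:)
  next
    case 3
    thus ?thesis by (simp add: chi_def Legendre_mult)
  qed
qed

lemma chi_mod:
  assumes "i dvd k"
  shows "chi i (n mod k) = chi i n"
proof -
  have "Legendre (int (n mod k)) (int i) = Legendre (int n) (int i)"
    using assms by (intro Legendre_cong) (simp only: cong_int_iff, simp add: cong_def mod_mod_cancel)
  moreover have "n mod k mod i = n mod i" using assms by (rule mod_mod_cancel)
  hence "i = 4 \<Longrightarrow> n mod k mod 4 = n mod 4" "i = 8 \<Longrightarrow> n mod k mod 8 = n mod 8" by simp_all
  ultimately show ?thesis unfolding chi_def by (simp only: cong: if_cong)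
qed

lemma chi_1: "i \<in> {4, 8} \<or> prime i \<Longrightarrow> chi i 1 = 1"
  using Legendre_1[of i] by (auto simp: chi_def)

lemma chi_cong:
  assumes "[a = b] (mod i)"
  shows "chi i a = chi i b"
proof -
  have "chi i a = chi i (a mod i)" by (simp only: chi_mod dvd_refl)
  also have "a mod i = b mod i" using assms by (simp add: cong_def)
  also have "chi i (b mod i) = chi i b" by (simp only: chi_mod dvd_refl)
  finally show ?thesis .
qed

lemma chi_coprime:
  assumes "i \<in> {4, 8} \<or> prime i" "coprime n i"
  shows "chi i n \<in> {-1, 1}"
proof -
  have odd: "odd n" if "i \<in> {4, 8}"
  proof
    assume "even n"
    moreover have "even i" using that by auto
    ultimately show False using assms(2) by (meson coprime_common_divisor odd_one)
  qed
  consider "i = 4" | "i = 8" | "prime i" "i \<noteq> 4" "i \<noteq> 8" using assms by blast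
  thus ?thesis
  proof cases
    case 1
    hence "odd n" using odd by simp
    hence "n mod 4 = 1 \<or> n mod 4 = 3" by presburger
    thus ?thesis unfolding 1 by (elim disjE) (simp_all add: chi_def)
  next
    case 2
    hence "odd n" using odd by simp
    hence "n mod 8 = 1 \<or> n mod 8 = 3 \<or> n mod 8 = 5 \<or> n mod 8 = 7" by presburger
    thus ?thesis unfolding 2 by (elim disjE) (simp_all add: chi_def)
  next
    case 3
    have "\<not> i dvd n"
      using 3 coprime_common_divisor[OF assms(2), of i] not_prime_unit by auto
    hence "Legendre (int n) (int i) \<noteq> 0" by (simp add: Legendre_eq_0_iff)
    thus ?thesis using 3 Legendre_values[of "int n" "int i"] by (auto simp: chi_def)
  qed
qed

text \<open>The characters modulo 4 and 8 join the Legendre symbols over the common modulus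
  \<open>k\<close>; the Chinese remainder theorem shows their independence.\<close>

theorem prime_with_prescribed_Legendre:
  fixes Q :: "nat set" and \<epsilon> :: "nat \<Rightarrow> int"
  assumes "finite Q" and Q: "\<And>p. p \<in> Q \<Longrightarrow> prime p \<and> p > 2"
    and eps: "\<And>p. p \<in> Q \<Longrightarrow> \<epsilon> p \<in> {-1, 1}"
  obtains q where "prime q" "q mod 8 = 7" "\<And>p. p \<in> Q \<Longrightarrow> Legendre (int q) (int p) = \<epsilon> p"
proof -
  define I where "I = {4, 8} \<union> Q"
  define k where "k = 8 * \<Prod>Q"
  have not48: "4 \<notin> Q" "8 \<notin> Q"
  proof -
    have "\<not> prime (4 :: nat)" "\<not> prime (8 :: nat)"
      using prime_product[of 2 2] prime_product[of 2 4] by auto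
    thus "4 \<notin> Q" "8 \<notin> Q" using Q by blast+
  qed
  have I: "i \<in> {4, 8} \<or> prime i \<and> i > 2" if "i \<in> I" for i using that Q by (auto simp: I_def)
  have dvd_prod: "p dvd \<Prod>P" if "p \<in> P" "P \<subseteq> Q" for p P
    using dvd_prodI[of P p "\<lambda>x. x"] that finite_subset[OF that(2) \<open>finite Q\<close>] by simp
  have dvd: "i dvd k" if "i \<in> I" for i
  proof -
    consider "i dvd 8" | "i \<in> Q" using \<open>i \<in> I\<close> by (auto simp: I_def)
    thus ?thesis by cases (auto simp: k_def intro: dvd_mult dvd_mult2 dvd_prod)
  qed
  have "k > 0" using Q by (auto simp: k_def prod_pos prime_gt_0_nat)
  \<comment> \<open>The values -1 at 4 and 1 at 8 single out 7 modulo 8; the value -1 at 4 also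
    excludes even prime powers in the general theorem.\<close>
  define \<epsilon>' where "\<epsilon>' = \<epsilon>(4 := -1, 8 := 1)"
  have cop_chi: "chi i n \<in> {-1, 1}" if "i \<in> I" "coprime n k" for i n
    using I[OF that(1)] dvd[OF that(1)] that(2)
    by (intro chi_coprime) (auto intro: coprime_imp_coprime dvd_trans)
  have cop8: "coprime 8 (\<Prod>Q)"
  proof (rule prod_coprime_right)
    fix p assume "p \<in> Q"
    hence "coprime 2 p" using Q by (metis coprime_commute primes_coprime two_is_prime_nat nat_neq_iff)
    hence "coprime (2 ^ 3) p" by (simp only: coprime_power_left_iff simp_thms)
    thus "coprime 8 p" by simp
  qed
  have indep: "\<exists>a. coprime a k \<and> (\<Prod>i\<in>S. chi i a) = -1" if S: "S \<subseteq> I" "S \<noteq> {}" for S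
  proof (cases "S \<subseteq> {4, 8}")
    case True
    \<comment> \<open>At 3 both characters are -1, which settles the singletons; at 5 only the one
      modulo 8 is -1, which settles the pair.\<close>
    define c :: nat where "c = (if S = {4, 8} then 5 else 3)"
    obtain a where a: "[a = c] (mod 8)" "[a = 1] (mod \<Prod>Q)"
      using binary_chinese_remainder_nat[OF cop8] by blast
    have a4: "[a = c] (mod 4)" using a(1) by (rule cong_dvd_modulus_nat) simp
    have "a mod 8 = c" using a(1) by (simp add: cong_def c_def split: if_splits)
    hence "odd a" unfolding c_def by (simp split: if_splits; presburger)
    hence "coprime a (2 ^ 3)" by (simp only: coprime_power_right_iff coprime_right_2_iff_odd simp_thms)
    hence "coprime a 8" by simp
    moreover have "coprime a (\<Prod>Q)" using cong_imp_coprime[OF cong_sym[OF a(2)]] by simp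
    ultimately have "coprime a k" by (simp add: k_def)
    moreover have "S = {4} \<or> S = {8} \<or> S = {4, 8}" using True S(2) by blast
    hence "(\<Prod>i\<in>S. chi i a) = -1"
      unfolding c_def by (elim disjE) (use chi_cong[OF a(1)] chi_cong[OF a4] in \<open>auto simp: chi_def c_def\<close>)
    ultimately show ?thesis by blast
  next
    case False
    \<comment> \<open>A nonresidue modulo one \<open>p\<close> in \<open>S\<close>, taken to be 1
      modulo the rest of \<open>k\<close>, makes the factor at \<open>p\<close> the only one equal
      to -1.\<close>
    then obtain p where p: "p \<in> S" "p \<in> Q" using S by (auto simp: I_def)
    obtain r where r: "Legendre (int r) (int p) = -1" using nonresidue_exists[of p] Q[OF p(2)] by blast
    have p48: "p \<noteq> 4" "p \<noteq> 8" using p not48 by auto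
    have "coprime p 8" using cop8 p \<open>finite Q\<close> by (metis coprime_commute coprime_divisors dvd_prodI dvd_refl id_apply)
    moreover have "coprime p (\<Prod>(Q - {p}))"
      using Q p by (intro prod_coprime_right) (auto intro: primes_coprime)
    ultimately have "coprime p (8 * \<Prod>(Q - {p}))" by simp
    then obtain a where a: "[a = r] (mod p)" "[a = 1] (mod 8 * \<Prod>(Q - {p}))"
      using binary_chinese_remainder_nat by blast
    have k: "k = p * (8 * \<Prod>(Q - {p}))"
      using prod.remove[OF \<open>finite Q\<close> p(2), of id] by (simp add: k_def)
    have chip: "chi p a = -1" using chi_cong[OF a(1)] r p48 by (simp add: chi_def)
    have "\<not> p dvd a"
    proof
      assume "p dvd a"
      hence "chi p a = 0" using p48 by (simp add: chi_def Legendre_eq_0_iff)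
      thus False using chip by simp
    qed
    hence "coprime a p" using Q[OF p(2)] by (metis coprime_commute prime_imp_coprime)
    moreover have "coprime a (8 * \<Prod>(Q - {p}))" using cong_imp_coprime[OF cong_sym[OF a(2)]] by simp
    ultimately have "coprime a k" unfolding k by simp
    moreover have "chi i a = 1" if i: "i \<in> S - {p}" for i
    proof -
      have iI: "i \<in> I" using i S by auto
      consider "i dvd 8" | "i \<in> Q - {p}" using i iI by (auto simp: I_def)
      hence "i dvd 8 * \<Prod>(Q - {p})" by cases (auto intro: dvd_mult dvd_mult2 dvd_prod)
      hence "[a = 1] (mod i)" using a(2) cong_dvd_modulus_nat by blast
      hence "chi i a = chi i 1" by (rule chi_cong)
      thus ?thesis using chi_1[of i] I[OF iI] by auto
    qed
    hence "(\<Prod>i\<in>S - {p}. chi i a) = 1" by (intro prod.neutral) auto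
    moreover have "finite S" using S \<open>finite Q\<close> by (auto simp: I_def intro: finite_subset)
    ultimately show ?thesis using chip prod.remove[of S p "\<lambda>i. chi i a"] p by auto
  qed
  obtain q where q: "prime q" "\<And>i. i \<in> I \<Longrightarrow> real_of_int (chi i q) = real_of_int (\<epsilon>' i)"
  proof (rule prime_with_prescribed_characters[of I k "\<lambda>i n. real_of_int (chi i n)" "\<lambda>i. real_of_int (\<epsilon>' i)" 4])
    show "finite I" using \<open>finite Q\<close> by (simp add: I_def)
    show "real_of_int (chi i (m * n)) = real_of_int (chi i m) * real_of_int (chi i n)" if "i \<in> I" for i m n
      using chi_mult[OF I[OF that]] by simp
    show "real_of_int (chi i n) \<in> {-1, 1}" if "i \<in> I" "coprime n k" for i n
      using cop_chi[OF that] by auto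
    show "real_of_int (chi i (n mod k)) = real_of_int (chi i n)" if "i \<in> I" for i n
      using chi_mod[OF dvd[OF that]] by simp
    show "\<exists>a. coprime a k \<and> (\<Prod>i\<in>S. real_of_int (chi i a)) = -1" if S: "S \<subseteq> I" "S \<noteq> {}" for S
    proof -
      obtain a where a: "coprime a k" "(\<Prod>i\<in>S. chi i a) = -1" using indep[OF S] by blast
      have "(\<Prod>i\<in>S. real_of_int (chi i a)) = real_of_int (\<Prod>i\<in>S. chi i a)" by simp
      thus ?thesis using a by auto
    qed
    show "real_of_int (\<epsilon>' i) \<in> {-1, 1}" if "i \<in> I" for i
    proof -
      have "\<epsilon>' i = -1 \<or> \<epsilon>' i = 1" using eps that by (auto simp: \<epsilon>'_def I_def)
      thus ?thesis by auto
    qed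
    show "4 \<in> I" "real_of_int (\<epsilon>' 4) = -1" by (simp_all add: I_def \<epsilon>'_def)
  qed (use \<open>k > 0\<close> in blast)+
  have "chi 4 q = -1" "chi 8 q = 1" using q(2)[of 4] q(2)[of 8] by (simp_all add: I_def \<epsilon>'_def)
  hence "q mod 4 = 3" "q mod 8 = 1 \<or> q mod 8 = 7" by (auto simp: chi_def split: if_splits)
  hence "q mod 8 = 7" by presburger
  moreover have "Legendre (int q) (int p) = \<epsilon> p" if "p \<in> Q" for p
  proof -
    have "p \<noteq> 4" "p \<noteq> 8" using that not48 by auto
    thus ?thesis using q(2)[of p] that by (simp add: I_def \<epsilon>'_def chi_def)
  qed
  ultimately show ?thesis using that q(1) by blast
qed

lemma Legendre_eq_1_if_prime_factors:
  assumes "prime q" "q > 2" "m > 0"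
    and "\<And>p. prime p \<Longrightarrow> p dvd m \<Longrightarrow> Legendre (int p) (int q) = 1"
  shows "Legendre (int m) (int q) = 1"
  using assms(3,4)
proof (induction m rule: prime_divisors_induct)
  case (unit m)
  thus ?case using Legendre_1[OF assms(1)] by simp
next
  case (factor p m)
  hence "Legendre (int m) (int q) = 1" by (cases "m = 0") auto
  thus ?case using factor.prems(2)[of p] factor.hyps Legendre_mult[OF assms(1,2)] by simp
qed simp

text \<open>Square roots modulo the distinct primes are glued by the Chinese remainder theorem;
  squarefreeness provides the coprime moduli.\<close>

lemma squarefree_quadratic_residue:
  fixes m :: nat and a :: int
  assumes "squarefree m" and "\<And>p. prime p \<Longrightarrow> p dvd m \<Longrightarrow> \<exists>r. int p dvd r^2 - a"
  shows "\<exists>r. int m dvd r^2 - a"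
  using assms
proof (induction m rule: prime_divisors_induct)
  case (factor p m)
  have sf: "squarefree m" using factor.prems(1) by (rule squarefree_mono[rotated]) simp
  have "\<not> p dvd m"
  proof
    assume "p dvd m"
    hence "p ^ 2 dvd p * m" by (simp add: power2_eq_square)
    thus False using factor squarefreeD not_prime_unit by blast
  qed
  hence cop: "coprime (int p) (int m)" using factor.hyps by (simp add: prime_imp_coprime)
  obtain r1 where r1: "int p dvd r1^2 - a" using factor.prems(2)[of p] factor.hyps by auto
  obtain r2 where r2: "int m dvd r2^2 - a" using factor.IH[OF sf] factor.prems(2) by auto
  obtain r where r: "[r = r1] (mod int p)" "[r = r2] (mod int m)"
    using binary_chinese_remainder_int[OF cop] by blast
  have "[r^2 = a] (mod int p)" "[r^2 = a] (mod int m)"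
    using r r1 r2 by (meson cong_iff_dvd_diff cong_pow cong_trans)+
  hence "int p * int m dvd r^2 - a" using cop by (simp add: cong_iff_dvd_diff divides_mult)
  thus ?case by auto
next
  case (unit m)
  hence "int m dvd 0^2 - a" by simp
  thus ?case by blast
qed simp

lemma prime_not_square:
  assumes "prime q"
  shows "k^2 \<noteq> int q"
proof
  assume "k^2 = int q"
  hence "(nat \<bar>k\<bar>)^2 = q" by (metis nat_int nat_power_eq abs_ge_zero power2_abs)
  hence "prime ((nat \<bar>k\<bar>)^2)" using assms by simp
  thus False by (simp add: prime_power_iff)
qed

subsection \<open>The ternary form\<close>

lemma tern_rep_squarefree:
  fixes m :: nat
  assumes sf: "squarefree m" and m3: "\<not> 3 dvd m"
  shows "tern_rep (int m)"
proof -
  have "m > 0" using sf by (cases m) auto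
  define P where "P = {p\<in>prime_factors m. p > 2}"
  have P: "prime p \<and> p > 2" if "p \<in> insert 3 P" for p
    using that by (auto simp: P_def in_prime_factors_iff)
  \<comment> \<open>The value at \<open>p\<close> in \<open>P\<close> makes \<open>- int q\<close> a
    residue modulo \<open>p\<close>; the value 1 at 3 makes \<open>q\<close> a residue modulo 3.
    There is no conflict, since 3 does not divide \<open>m\<close>.\<close>
  define \<epsilon> where "\<epsilon> = (\<lambda>p. if p = 3 then 1 else Legendre (-1) (int p))"
  have eps: "\<epsilon> p \<in> {-1, 1}" if "p \<in> insert 3 P" for p
    using P[OF that] by (simp add: \<epsilon>_def Legendre_minus_1 minus_one_power_iff)
  have "finite (insert 3 P)" by (simp add: P_def)
  then obtain q where q: "prime q" "q mod 8 = 7" "\<And>p. p \<in> insert 3 P \<Longrightarrow> Legendre (int q) (int p) = \<epsilon> p"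
    using prime_with_prescribed_Legendre[of "insert 3 P" \<epsilon>] P eps by blast
  have "q \<ge> 7" "odd q" using q(2) by presburger+
  hence q2: "q > 2" and q3: "q \<noteq> 3" by simp_all
  have odd: "odd ((q - 1) div 2)" using q(2) by presburger
  have notP: "p \<noteq> q" if "p \<in> insert 3 P" for p
  proof
    assume "p = q"
    hence "\<epsilon> q = 0" using q(3)[OF that] Legendre_eq_0_iff[of "int q" "int q"] by simp
    thus False using eps[OF that] \<open>p = q\<close> by simp
  qed
  \<comment> \<open>As q is 3 modulo 4, the reciprocity sign depends on \<open>p\<close> alone and
    equals the symbol of -1. For \<open>p\<close> in \<open>P\<close> this cancels against the
    choice of \<open>\<epsilon> p\<close>.\<close>
  have recip: "Legendre (int p) (int q) * \<epsilon> p = Legendre (-1) (int p)" if p: "p \<in> insert 3 P" for p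
  proof -
    have "Legendre (int p) (int q) * Legendre (int q) (int p) = (-1) ^ ((p - 1) div 2 * ((q - 1) div 2))"
      using Quadratic_Reciprocity[of p q] P[OF p] q(1) q2 notP[OF p] by blast
    also have "\<dots> = (-1) ^ ((p - 1) div 2)" using odd by (simp add: minus_one_power_iff)
    also have "\<dots> = Legendre (-1) (int p)" using P[OF p] by (simp add: Legendre_minus_1)
    finally show ?thesis using q(3)[OF p] by simp
  qed
  have pq: "Legendre (int p) (int q) = 1" if "prime p" "p dvd m" for p
  proof (cases "p = 2")
    case True
    thus ?thesis using Legendre_2[OF q(1,2)] by simp
  next
    case False
    hence p: "p \<in> P" "p \<noteq> 3" using that m3 \<open>m > 0\<close> prime_ge_2_nat[of p]
      by (auto simp: P_def in_prime_factors_iff)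
    thus ?thesis using recip[of p] eps[of p] by (auto simp: \<epsilon>_def)
  qed
  have "Legendre (int m) (int q) = 1"
    using q(1) q2 \<open>m > 0\<close> pq by (rule Legendre_eq_1_if_prime_factors)
  then obtain s where s: "int q dvd s^2 - int m" by (rule Legendre_eq_1D)
  have "\<exists>r. int m dvd r^2 - (- int q)"
    using sf
  proof (rule squarefree_quadratic_residue)
    fix p assume p: "prime p" "p dvd m"
    show "\<exists>r. int p dvd r^2 - (- int q)"
    proof (cases "p = 2")
      case True
      have "int p dvd 1^2 - (- int q)" using True \<open>odd q\<close> by simp
      thus ?thesis by blast
    next
      case False
      hence pP: "p \<in> P" "p \<noteq> 3" using p m3 \<open>m > 0\<close> prime_ge_2_nat[of p]
        by (auto simp: P_def in_prime_factors_iff)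
      have "Legendre (- int q) (int p) = Legendre (-1) (int p) * Legendre (int q) (int p)"
        using Legendre_mult[of p "-1" "int q"] P pP by simp
      also have "\<dots> = \<epsilon> p * \<epsilon> p" using q(3)[of p] pP by (simp add: \<epsilon>_def)
      also have "\<dots> = 1" using eps[of p] pP by auto
      finally show ?thesis by (metis Legendre_eq_1D)
    qed
  qed
  then obtain r where r: "int m dvd r^2 + int q" by auto
  have "\<not> q dvd m" using pq[of q] q(1) Legendre_eq_0_iff[of "int q" "int q"] by auto
  hence "coprime (int q) (int m)" using q(1) by (simp add: prime_imp_coprime)
  from legendre_ternary[OF _ _ this prime_not_square[OF q(1)] r s]
  obtain x y z where xyz: "z \<noteq> 0" "x^2 + int q * y^2 = int m * z^2"
    using \<open>m > 0\<close> q2 by (metis less_trans of_nat_0_less_iff zero_less_numeral)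
  \<comment> \<open>Both 3 and -1 are nonresidues modulo \<open>q\<close>, so -3 is a residue: this
    is the remaining condition for u^2 + 3 v^2 = q t^2.\<close>
  have "Legendre (int 3) (int q) = -1"
    using recip[of 3] Legendre_minus_1[of 3] by (simp add: \<epsilon>_def)
  moreover have "Legendre (-1) (int q) = -1" using Legendre_minus_1[OF q(1) q2] odd by simp
  ultimately have "Legendre (-3) (int q) = 1"
    using Legendre_mult[OF q(1) q2, of "-1" 3] by simp
  then obtain r' where r': "int q dvd r'^2 - (-3)" by (rule Legendre_eq_1D)
  have "Legendre (int q) (int 3) = 1" using q(3)[of 3] by (simp add: \<epsilon>_def)
  then obtain s' where s': "int 3 dvd s'^2 - int q" by (rule Legendre_eq_1D)
  have prime3: "prime (3 :: nat)" by simp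
  have "coprime (3 :: nat) q" using primes_coprime[OF prime3 q(1)] q3 by simp
  hence cop3: "coprime (int 3) (int q)" by (simp only: coprime_int_iff)
  have "int q dvd r'^2 + int 3" "0 < int q" "0 < int 3" using r' q2 by simp_all
  then obtain u v t where uvt: "t \<noteq> 0" "u^2 + 3 * v^2 = int q * t^2"
    using legendre_ternary[OF _ _ cop3 prime_not_square[OF prime3] _ s'] by (metis of_nat_numeral)
  \<comment> \<open>The second equation replaces \<open>q\<close> times a square in the first by a
    value of p^2 + 3 q^2, that is, of \<open>eis\<close>.\<close>
  have "int m * (z * t)^2 = (int m * z^2) * t^2" by (simp add: power_mult_distrib)
  also have "\<dots> = (x * t)^2 + y^2 * (int q * t^2)"
    unfolding xyz(2)[symmetric] by (simp add: power_mult_distrib algebra_simps)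
  also have "\<dots> = (x * t)^2 + ((y * u)^2 + 3 * (y * v)^2)"
    unfolding uvt(2)[symmetric] by (simp add: power_mult_distrib algebra_simps)
  finally have "int m * (z * t)^2 = (x * t)^2 + eis (y * u - y * v) (2 * (y * v))"
    by (simp only: diag_eis)
  moreover have "z * t \<noteq> 0" using xyz(1) uvt(1) by simp
  ultimately show ?thesis using davenport_cassels unfolding tern_rep_def by metis
qed

text \<open>The square part of \<open>m\<close> is restored by scaling, and the squarefree part
  inherits indivisibility by 3.\<close>

theorem tern_rep_if_not_3_dvd:
  assumes "m > 0" "\<not> 3 dvd m"
  shows "tern_rep m"
proof -
  define n where "n = nat m"
  have m: "m = int n" using assms by (simp add: n_def)
  have n: "n = square_part n ^ 2 * squarefree_part n"
    using squarefree_decompose[of n] by (simp add: mult.commute)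
  have "squarefree_part n dvd n" using n by (metis dvd_triv_right)
  hence "\<not> 3 dvd squarefree_part n" using assms m by (metis dvd_trans of_nat_dvd_iff of_nat_numeral)
  hence "tern_rep (int (squarefree_part n))" by (intro tern_rep_squarefree) auto
  hence "tern_rep (int (square_part n) ^ 2 * int (squarefree_part n))" by (rule tern_rep_scale)
  moreover have "int (square_part n) ^ 2 * int (squarefree_part n) = m"
    unfolding m by (subst (3) n) simp
  ultimately show ?thesis by simp
qed

theorem theorem3p4:
  fixes b :: int
  assumes "b > 0"
  shows "(\<forall>n::int. n \<ge> 0 \<longrightarrow>
            (\<exists>x y z w :: int. n = x^2 + b * y^2 + (z^2 + z * w + w^2)))
         \<longleftrightarrow> b \<in> {1, 2, 3, 4, 5, 6}"
proof -
  have "(\<forall>n\<ge>0. quat_rep b n) \<longleftrightarrow> b \<in> {1, 2, 3, 4, 5, 6}"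
  proof
    assume "\<forall>n\<ge>0. quat_rep b n"
    hence "quat_rep b 6" by simp
    hence "b < 7" using not_quat_rep_6[of b] by linarith
    thus "b \<in> {1, 2, 3, 4, 5, 6}" using assms unfolding insert_iff empty_iff by presburger
  next
    assume b: "b \<in> {1, 2, 3, 4, 5, 6}"
    show "\<forall>n\<ge>0. quat_rep b n"
    proof (intro allI impI)
      fix n :: int assume "n \<ge> 0"
      consider "b = 3" | "b = 6" | "b \<in> {1, 2, 4, 5}" using b by blast
      thus "quat_rep b n"
      proof cases
        case 1
        show ?thesis unfolding 1 by (rule quat_rep_3[OF tern_rep_if_not_3_dvd \<open>n \<ge> 0\<close>])
      next
        case 2
        show ?thesis unfolding 2 by (rule quat_rep_6[OF tern_rep_if_not_3_dvd \<open>n \<ge> 0\<close>])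
      next
        case 3
        show ?thesis by (rule quat_rep_1_2_4_5[OF tern_rep_if_not_3_dvd \<open>n \<ge> 0\<close> 3])
      qed
    qed
  qed
  thus ?thesis by (simp add: quat_rep_def eis_def)
qed

end
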